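(* Let $\alpha,\beta,\gamma$ be complex numbers with $\operatorname{Re}(\alpha+\beta-\gamma)>0$ and $\alpha,\beta,\gamma\notin\mathbb{Z}_{\le 0}$, and put $t=\alpha+\beta-\gamma$. Let $d\ge 1$ and let $k_{1},\ldots,k_{d}$ be integers with $k_{i}\ge 2$ for every $1\le i\le d$. Put $k\coloneqq k_{1}+\cdots+k_{d}$. Then \begin{multline*} \sum_{i=1}^{d}\sum_{j=0}^{k_{i}-3}Z_{I}^{\star}(j+1,k_{i+1},\ldots,k_{d},k_{1},\ldots,k_{i-1},k_{i}-j;\alpha,\beta,\gamma) +t\sum_{i=1}^{d}Z_{II}^{\star}(k_{i},\ldots,k_{d},k_{1},\ldots,k_{i-1},2;\alpha,\beta,\gamma)\\ =dZ(d\mid d+1\mid k-2d;\alpha,\beta,\gamma)+dZ(d+1\mid d\mid k-2d;\alpha,\beta,\gamma)+(k-2d)Z(d\mid d\mid k-2d+1;\alpha,\beta,\gamma). \end{multline*}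
   Context: $(a)_{m}=a(a+1)\cdots(a+m-1)$ denotes the Pochhammer symbol, $(a)_0=1$. For positive integers $k_{1},\ldots,k_{d}$ with $k_{d}\ge 2$, \[Z_{I}^{\star}(k_{1},\ldots,k_{d};\alpha,\beta,\gamma)=\sum_{0\le m_{1}\le\cdots\le m_{d}}\frac{(\alpha)_{m_{1}}(\beta)_{m_{1}}}{(\gamma)_{m_{1}}m_{1}!}\frac{(\gamma)_{m_{d}}m_{d}!}{(\alpha)_{m_{d}}(\beta)_{m_{d}}}\frac{1}{(m_{1}+\gamma)^{k_{1}}}\prod_{i=2}^{d}\frac{1}{(m_{i}+\alpha)(m_{i}+\beta)(m_{i}+\gamma)^{k_{i}-2}}.\] For integers $k_{1},\ldots,k_{d}\ge 2$, \[Z_{II}^{\star}(k_{1},\ldots,k_{d};\alpha,\beta,\gamma)=\sum_{0\le m_{0}\le m_{1}\le\cdots\le m_{d}}\frac{(\alpha)_{m_{0}}(\beta)_{m_{0}}}{(\gamma)_{m_{0}}m_{0}!}\frac{(\gamma)_{m_{d}}m_{d}!}{(\alpha)_{m_{d}}(\beta)_{m_{d}}}\prod_{i=1}^{d}\frac{1}{(m_{i}+\alpha)(m_{i}+\beta)(m_{i}+\gamma)^{k_{i}-2}}.\] For integers $a,b,c$ with $a+b+c\ge 2$, $Z(a\mid b\mid c;\alpha,\beta,\gamma)=\sum_{n=0}^{\infty}\frac{1}{(n+\alpha)^{a}(n+\beta)^{b}(n+\gamma)^{c}}$. Inner sums over $j$ from $0$ to $k_i-3$ are empty when $k_i=2$.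 *)

theory Defs
  imports "HOL-Analysis.Analysis"
begin

text \<open>
  The indices \<open>k\<^sub>1, \<dots>, k\<^sub>d\<close> form a nonempty list \<open>ks\<close>, and the summation variables form a
  nondecreasing list \<open>m\<close> of naturals; the multiple series are unordered (absolutely convergent)
  sums over all such lists. List positions count from 0. The exponents \<open>k\<^sub>i - 2\<close> may be \<open>-1\<close>, so
  they are taken in the integers.
\<close>

definition hyp_weight :: "complex \<Rightarrow> complex \<Rightarrow> complex \<Rightarrow> nat \<Rightarrow> complex" where
  "hyp_weight \<alpha> \<beta> \<gamma> n =
     (pochhammer \<alpha> n * pochhammer \<beta> n) / (pochhammer \<gamma> n * fact n)"

definition hyp_weight_inv :: "complex \<Rightarrow> complex \<Rightarrow> complex \<Rightarrow> nat \<Rightarrow> complex" where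
  "hyp_weight_inv \<alpha> \<beta> \<gamma> n =
     (pochhammer \<gamma> n * fact n) / (pochhammer \<alpha> n * pochhammer \<beta> n)"

text \<open>Here \<open>m ! (i - 1)\<close> is \<open>m\<^sub>i\<close> for \<open>1 \<le> i \<le> d\<close>.\<close>

definition Z_I_star :: "nat list \<Rightarrow> complex \<Rightarrow> complex \<Rightarrow> complex \<Rightarrow> complex" where
  "Z_I_star ks \<alpha> \<beta> \<gamma> =
     (\<Sum>\<^sub>\<infinity>m\<in>{m :: nat list. length m = length ks \<and> sorted m}.
        hyp_weight \<alpha> \<beta> \<gamma> (hd m) * hyp_weight_inv \<alpha> \<beta> \<gamma> (last m) *
        (1 / (of_nat (hd m) + \<gamma>) ^ hd ks) *
        (\<Prod>i=2..length ks.
           1 / ((of_nat (m ! (i - 1)) + \<alpha>) * (of_nat (m ! (i - 1)) + \<beta>) *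
                (of_nat (m ! (i - 1)) + \<gamma>) powi (int (ks ! (i - 1)) - 2))))"

text \<open>Here there is one more variable, \<open>m\<^sub>0\<close>: \<open>m ! i\<close> is \<open>m\<^sub>i\<close> for \<open>0 \<le> i \<le> d\<close>,
  while \<open>ks ! (i - 1)\<close> is \<open>k\<^sub>i\<close>.\<close>

definition Z_II_star :: "nat list \<Rightarrow> complex \<Rightarrow> complex \<Rightarrow> complex \<Rightarrow> complex" where
  "Z_II_star ks \<alpha> \<beta> \<gamma> =
     (\<Sum>\<^sub>\<infinity>m\<in>{m :: nat list. length m = length ks + 1 \<and> sorted m}.
        hyp_weight \<alpha> \<beta> \<gamma> (hd m) * hyp_weight_inv \<alpha> \<beta> \<gamma> (last m) *
        (\<Prod>i=1..length ks.
           1 / ((of_nat (m ! i) + \<alpha>) * (of_nat (m ! i) + \<beta>) *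
                (of_nat (m ! i) + \<gamma>) powi (int (ks ! (i - 1)) - 2))))"

definition Z :: "int \<Rightarrow> int \<Rightarrow> int \<Rightarrow> complex \<Rightarrow> complex \<Rightarrow> complex \<Rightarrow> complex" where
  "Z a b c \<alpha> \<beta> \<gamma> =
     (\<Sum>n. 1 / ((of_nat n + \<alpha>) powi a * (of_nat n + \<beta>) powi b * (of_nat n + \<gamma>) powi c))"

end

theory Submission
  imports Defs
begin

text \<open>
  Write \<open>w\<close> for the hypergeometric weight, \<open>v = 1 / w\<close>, \<open>u n = v n / ((n + \<alpha>) (n + \<beta>))\<close>,
  \<open>s n = w n (n + \<alpha>) (n + \<beta>)\<close>, and let \<open>P k n\<close> be the factor of the product belonging to the
  index \<open>k\<close>. The geometric sum over \<open>j\<close> turns the \<open>Z_I\<close> terms into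
  \<open>((m + \<gamma>) ^ (2 - k\<^sub>i) - (n + \<gamma>) ^ (2 - k\<^sub>i)) / (n - m)\<close> for the outer variables \<open>m < n\<close>, plus a
  diagonal contribution that is a multiple of \<open>Z(d | d | k - 2d + 1)\<close>. This gives the difference of a
  head sum for \<open>(k\<^sub>i, \<dots>, k\<^sub>i\<^sub>-\<^sub>1)\<close> and a tail sum for the next rotation, so summed over the cycle the head
  and the tail sum of the same rotation may be compared. With the variables \<open>p \<le> \<dots> \<le> q\<close> carrying
  the product held fixed, this reduces to the two-variable identity
  \<open>s p * (\<Sum>n. u n / (n - p)) + t * (\<Sum>m\<le>p. \<Sum>n. w m * u n)
     = v q * (\<Sum>m\<le>p. w m / (q - m)) + [p = q] (1 / (p + \<alpha>) + 1 / (p + \<beta>))\<close>,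
  with \<open>n\<close> ranging over \<open>n \<ge> q\<close> and singular terms omitted. It telescopes in \<open>n\<close>, because
  the recurrences for \<open>w\<close> and \<open>v\<close> make it telescope in \<open>m\<close> as well.
  All series converge absolutely, as \<open>|w m|\<close> grows like \<open>m powr (Re t - 1)\<close>.
\<close>

subsection \<open>Summability over sorted lists\<close>

lemma summable_on_Times_nonneg:
  fixes f :: "'a \<Rightarrow> real" and g :: "'b \<Rightarrow> real"
  assumes f: "f summable_on A" "\<And>x. x \<in> A \<Longrightarrow> f x \<ge> 0"
    and g: "g summable_on B" "\<And>y. y \<in> B \<Longrightarrow> g y \<ge> 0"
  shows "(\<lambda>(x, y). f x * g y) summable_on A \<times> B"
proof (rule summable_on_SigmaI[where g = "\<lambda>x. f x * infsum g B"])
  show "((\<lambda>y. case (x, y) of (x, y) \<Rightarrow> f x * g y) has_sum f x * infsum g B) B" for x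
    using g(1) by (simp add: has_sum_cmult_right)
  show "(\<lambda>x. f x * infsum g B) summable_on A"
    by (rule summable_on_cmult_left) (rule f(1))
qed (use f g in auto)

lemma summable_on_prod_list:
  fixes g :: "'a \<Rightarrow> real"
  assumes "g summable_on UNIV" "\<And>x. g x \<ge> 0"
  shows "(\<lambda>xs. prod_list (map g xs)) summable_on {xs. length xs = N}"
proof (induction N)
  case 0
  then show ?case by simp
next
  case (Suc N)
  have nonneg: "prod_list (map g xs) \<ge> 0" for xs
    by (rule prod_list_nonneg) (use assms(2) in auto)
  have "(\<lambda>(x, xs). g x * prod_list (map g xs)) summable_on UNIV \<times> {xs. length xs = N}"
    using assms nonneg Suc by (intro summable_on_Times_nonneg) auto
  also have "?this \<longleftrightarrow> (\<lambda>xs. prod_list (map g xs)) summable_on {xs. length xs = Suc N}"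
    by (rule summable_on_reindex_bij_witness[where j = "\<lambda>(x, xs). x # xs" and i = "\<lambda>xs. (hd xs, tl xs)"])
      (auto simp: length_Suc_conv)
  finally show ?case .
qed

definition sorted_lists :: "nat \<Rightarrow> nat list set" where
  "sorted_lists N = {m. length m = N \<and> sorted m}"

lemma sorted_lists_framedE:
  assumes "l \<in> sorted_lists (Suc (Suc N))"
  obtains m mid n where "l = m # mid @ [n]" "length mid = N" "sorted (m # mid @ [n])" "m \<le> n"
proof -
  from assms obtain m l' where l: "l = m # l'" "length l' = Suc N"
    by (auto simp: sorted_lists_def length_Suc_conv)
  then obtain mid n where "l' = mid @ [n]" "length mid = N"
    by (auto simp: length_Suc_conv_rev)
  with that l assms show thesis by (auto simp: sorted_lists_def)
qed

text \<open>Comparison test for all the multiple series: the two outer variables share the majorant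
  \<open>W m n\<close>, each middle variable has its own factor \<open>g\<close>, and dropping the
  order conditions on the middle variables makes the majorant a product. The condition
  \<open>m \<le> n\<close> is kept because \<open>W\<close> may involve n - m.\<close>

lemma abs_summable_on_framed:
  fixes f :: "nat list \<Rightarrow> complex" and W :: "nat \<Rightarrow> nat \<Rightarrow> real"
  assumes W: "(\<lambda>(m, n). W m n) summable_on {(m, n). m \<le> n}" "\<And>m n. m \<le> n \<Longrightarrow> W m n \<ge> 0"
    and g: "g summable_on UNIV" "\<And>n. g n \<ge> 0"
    and bound: "\<And>m mid n. length mid = N \<Longrightarrow> sorted (m # mid @ [n]) \<Longrightarrow>
      norm (f (m # mid @ [n])) \<le> C * (W m n * prod_list (map g mid))"
  shows "(\<lambda>l. norm (f l)) summable_on sorted_lists (Suc (Suc N))"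
proof -
  define D where "D = {((m :: nat, n), mid). length mid = N \<and> sorted (m # mid @ [n])}"
  have nonneg: "prod_list (map g xs) \<ge> 0" for xs
    by (rule prod_list_nonneg) (use g(2) in auto)
  have "(\<lambda>(mn, mid). (case mn of (m, n) \<Rightarrow> W m n) * prod_list (map g mid))
      summable_on {(m, n). m \<le> n} \<times> {mid. length mid = N}"
    by (intro summable_on_Times_nonneg summable_on_prod_list) (use W g nonneg in auto)
  then have "(\<lambda>(mn, mid). (case mn of (m, n) \<Rightarrow> W m n) * prod_list (map g mid)) summable_on D"
    by (rule summable_on_subset_banach) (auto simp: D_def)
  then have "(\<lambda>x. C * (case x of (mn, mid) \<Rightarrow> (case mn of (m, n) \<Rightarrow> W m n) * prod_list (map g mid)))
      summable_on D"
    by (rule summable_on_cmult_right)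
  then have "(\<lambda>z. norm (case z of ((m, n), mid) \<Rightarrow> f (m # mid @ [n]))) summable_on D"
    by (rule Infinite_Sum.abs_summable_on_comparison_test') (use bound in \<open>auto simp: D_def\<close>)
  also have "?this \<longleftrightarrow> (\<lambda>l. norm (f l)) summable_on sorted_lists (Suc (Suc N))"
    by (rule summable_on_reindex_bij_witness[where j = "\<lambda>((m, n), mid). m # mid @ [n]"
          and i = "\<lambda>l. ((hd l, last l), butlast (tl l))"])
      (auto simp: D_def sorted_lists_def elim!: sorted_lists_framedE[unfolded sorted_lists_def, simplified])
  finally show ?thesis .
qed

section \<open>Convergent majorants and bounds for shifted inverses\<close>

lemma summable_on_powr:
  assumes "e < -1"
  shows "(\<lambda>n::nat. (real n + 1) powr e) summable_on UNIV"
proof -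
  have "summable (\<lambda>n. real (Suc n) powr e)"
    unfolding summable_Suc_iff[of "\<lambda>n. real n powr e"] summable_real_powr_iff by (rule assms)
  then show ?thesis
    by (subst summable_on_UNIV_nonneg_real_iff) (simp_all add: add.commute)
qed

lemma summable_on_powr_pairs:
  assumes "e < -1"
  shows "(\<lambda>(m, n). (real m + 1) powr e * (real n + 1) powr e) summable_on {(m, n). m \<le> n}"
proof (rule summable_on_subset_banach)
  show "(\<lambda>(m, n). (real m + 1) powr e * (real n + 1) powr e) summable_on UNIV \<times> UNIV"
    by (intro summable_on_Times_nonneg summable_on_powr assms) auto
qed auto

text \<open>Writing \<open>a = m + 1\<close> and \<open>b = n - m\<close>, the summand is \<open>1 / (a b (a + b))\<close>, at most \<open>(a b) powr (-3/2)\<close>.\<close>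

lemma summable_on_kernel:
  "(\<lambda>(m, n). 1 / ((real m + 1) * (real n + 1) * (real n - real m))) summable_on {(m, n). m \<le> n}"
proof -
  have *: "1 / (a * b * (a + b)) \<le> a powr (-3/2) * b powr (-3/2)" if "a \<ge> 1" "b \<ge> 1" for a b :: real
  proof -
    have "a powr (1/2) * b powr (1/2) \<le> (a + b) powr (1/2) * (a + b) powr (1/2)"
      by (intro mult_mono powr_mono2) (use that in auto)
    also have "\<dots> = a + b"
      using that by (simp flip: powr_add)
    finally have "a * b * (a powr (1/2) * b powr (1/2)) \<le> a * b * (a + b)"
      using that by (intro mult_left_mono) auto
    moreover have "x powr (-3/2) = 1 / (x * x powr (1/2))" if "x \<ge> 1" for x :: real
    proof -
      have "x powr (3/2) = x powr 1 * x powr (1/2)"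
        by (simp only: powr_add[symmetric]) simp
      then show ?thesis using that by (simp add: powr_minus_divide)
    qed
    ultimately show ?thesis
      using that by (simp add: frac_le mult_ac)
  qed
  have "(\<lambda>(m, n). (real m + 1) powr (-3/2) * (real n + 1) powr (-3/2)) summable_on UNIV \<times> UNIV"
    by (intro summable_on_Times_nonneg summable_on_powr) auto
  then have "(\<lambda>(m, j). 1 / ((real m + 1) * (real j + 1) * ((real m + 1) + (real j + 1))))
      summable_on UNIV \<times> UNIV"
  proof (rule summable_on_comparison_test)
    fix z :: "nat \<times> nat"
    show "(case z of (m, j) \<Rightarrow> 1 / ((real m + 1) * (real j + 1) * ((real m + 1) + (real j + 1))))
        \<le> (case z of (m, n) \<Rightarrow> (real m + 1) powr (-3/2) * (real n + 1) powr (-3/2))"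
      using *[of "real (fst z) + 1" "real (snd z) + 1"] by (cases z) (simp del: powr_minus)
  qed auto
  also have "?this \<longleftrightarrow> (\<lambda>(m, n). 1 / ((real m + 1) * (real n + 1) * (real n - real m)))
      summable_on {(m, n). m < n}"
    by (rule summable_on_reindex_bij_witness[where j = "\<lambda>(m, j). (m, m + j + 1)"
          and i = "\<lambda>(m, n). (m, n - m - 1)"])
      (auto simp: add_ac mult_ac)
  \<comment> \<open>Adding the diagonal changes nothing: its terms are zero by division by
    zero.\<close>
  also have "\<dots> \<longleftrightarrow> (\<lambda>(m, n). 1 / ((real m + 1) * (real n + 1) * (real n - real m)))
      summable_on {(m, n). m \<le> n}"
    by (rule summable_on_cong_neutral) auto
  finally show ?thesis .
qed

lemma inverse_shift_bound:
  fixes z :: complex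
  assumes "z \<notin> \<int>\<^sub>\<le>\<^sub>0"
  obtains C where "C > 0" "\<And>n::nat. norm (1 / (of_nat n + z)) \<le> C * (real n + 1) powr -1"
proof -
  have "(\<lambda>n. 1 / (of_nat n + z)) \<longlonglongrightarrow> 0"
    by (intro tendsto_divide_0[OF tendsto_const] tendsto_add_filterlim_at_infinity'
        [OF tendsto_of_nat tendsto_const])
  \<comment> \<open>This sequence is (n + 1) / (n + z), written so that its limit is visible;
    convergence makes it bounded.\<close>
  then have "(\<lambda>n. 1 + (1 - z) * (1 / (of_nat n + z))) \<longlonglongrightarrow> 1 + (1 - z) * 0"
    by (intro tendsto_intros)
  then have "Bseq (\<lambda>n. 1 + (1 - z) * (1 / (of_nat n + z)))"
    by (intro convergent_imp_Bseq) (auto simp: convergent_def)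
  then obtain C where C: "C > 0" "\<And>n. norm (1 + (1 - z) * (1 / (of_nat n + z))) \<le> C"
    by (auto simp: Bseq_def)
  have "norm (1 / (of_nat n + z)) \<le> C * (real n + 1) powr -1" for n
  proof -
    have nz: "of_nat n + z \<noteq> 0"
      using assms plus_of_nat_eq_0_imp[of z n] by (auto simp: add.commute)
    then have "1 + (1 - z) * (1 / (of_nat n + z)) = of_real (real n + 1) * (1 / (of_nat n + z))"
      by (simp add: field_simps)
    then have "(real n + 1) * norm (1 / (of_nat n + z)) \<le> C"
      using C(2)[of n] by (simp only: norm_mult norm_of_real)
    then show ?thesis
      by (simp add: powr_minus_divide pos_le_divide_eq mult.commute)
  qed
  with C(1) that show thesis by blast
qed

lemma inverse_power_bound:
  fixes z :: complex
  assumes "z \<notin> \<int>\<^sub>\<le>\<^sub>0"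
  obtains C where "C > 0" "\<And>n::nat. norm ((1 / (of_nat n + z)) ^ i) \<le> C * (real n + 1) powr (- real i)"
proof -
  obtain C where C: "C > 0" "\<And>n::nat. norm (1 / (of_nat n + z)) \<le> C * (real n + 1) powr -1"
    using inverse_shift_bound[OF assms] by blast
  have "norm ((1 / (of_nat n + z)) ^ i) \<le> C ^ i * (real n + 1) powr (- real i)" for n
  proof -
    have "norm (1 / (of_nat n + z)) ^ i \<le> (C * (real n + 1) powr -1) ^ i"
      by (intro power_mono C) auto
    also have "\<dots> = C ^ i * (real n + 1) powr (- real i)"
      unfolding power_mult_distrib by (simp only: powr_realpow[symmetric] powr_powr zero_less_power2 powr_gt_zero) simp
    finally show ?thesis by (simp only: norm_power)
  qed
  with C(1) that[of "C ^ i"] show thesis by simp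
qed

section \<open>Splitting sums over sorted lists\<close>

lemma infsum_sum_finite:
  fixes f :: "'i \<Rightarrow> 'a \<Rightarrow> complex"
  assumes "\<And>i. i \<in> I \<Longrightarrow> f i summable_on A"
  shows "(\<lambda>x. \<Sum>i\<in>I. f i x) summable_on A \<and> (\<Sum>\<^sub>\<infinity>x\<in>A. \<Sum>i\<in>I. f i x) = (\<Sum>i\<in>I. infsum (f i) A)"
  using assms
proof (induction I rule: infinite_finite_induct)
  case (insert i I)
  then show ?case
    by (simp add: infsum_add summable_on_add)
qed auto

lemma sorted_lists_Cons_bij:
  "bij_betw (\<lambda>(p, m). m # p) (Sigma (sorted_lists (Suc N)) (\<lambda>p. {..hd p})) (sorted_lists (Suc (Suc N)))"
  by (rule bij_betwI[where g = "\<lambda>l. (tl l, hd l)"], auto simp: sorted_lists_def length_Suc_conv)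
    (meson order_trans)

lemma sorted_lists_snoc_bij:
  "bij_betw (\<lambda>(p, n). p @ [n]) (Sigma (sorted_lists (Suc N)) (\<lambda>p. {last p..})) (sorted_lists (Suc (Suc N)))"
proof (rule bij_betwI[where g = "\<lambda>l. (butlast l, last l)"])
  show "(\<lambda>(p, n). p @ [n]) \<in> Sigma (sorted_lists (Suc N)) (\<lambda>p. {last p..}) \<rightarrow> sorted_lists (Suc (Suc N))"
    by (auto simp: sorted_lists_def length_Suc_conv_rev sorted_append) (meson order_trans)
  show "(\<lambda>l. (butlast l, last l)) \<in> sorted_lists (Suc (Suc N)) \<rightarrow> Sigma (sorted_lists (Suc N)) (\<lambda>p. {last p..})"
    by (auto simp: sorted_lists_def length_Suc_conv_rev sorted_append butlast_append)
qed (auto simp: sorted_lists_def length_Suc_conv_rev butlast_append)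

text \<open>Fubini for the smallest variable. It is bounded by the head of the remaining list, so
  the inner sum is finite.\<close>

lemma sum_sorted_lists_Cons:
  fixes f :: "nat list \<Rightarrow> complex"
  assumes "f summable_on sorted_lists (Suc (Suc N))"
  shows "(\<lambda>p. \<Sum>m\<le>hd p. f (m # p)) summable_on sorted_lists (Suc N)"
    and "(\<Sum>\<^sub>\<infinity>p\<in>sorted_lists (Suc N). \<Sum>m\<le>hd p. f (m # p)) = infsum f (sorted_lists (Suc (Suc N)))"
proof -
  have sum: "(\<lambda>z. f (case z of (p, m) \<Rightarrow> m # p)) summable_on Sigma (sorted_lists (Suc N)) (\<lambda>p. {..hd p})"
    unfolding summable_on_reindex_bij_betw[OF sorted_lists_Cons_bij] by (rule assms)
  then show "(\<lambda>p. \<Sum>m\<le>hd p. f (m # p)) summable_on sorted_lists (Suc N)"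
    using summable_on_Sigma_banach[of "\<lambda>p m. f (m # p)" "sorted_lists (Suc N)" "\<lambda>p. {..hd p}"]
    by (simp add: case_prod_unfold)
  show "(\<Sum>\<^sub>\<infinity>p\<in>sorted_lists (Suc N). \<Sum>m\<le>hd p. f (m # p)) = infsum f (sorted_lists (Suc (Suc N)))"
    using infsum_Sigma_banach[OF sum] infsum_reindex_bij_betw[OF sorted_lists_Cons_bij, of f N] by simp
qed

text \<open>Fubini for the largest variable. Its range is infinite, so summability of the inner
  series is recorded as well.\<close>

lemma sum_sorted_lists_snoc:
  fixes f :: "nat list \<Rightarrow> complex"
  assumes "f summable_on sorted_lists (Suc (Suc N))"
  shows "p \<in> sorted_lists (Suc N) \<Longrightarrow> (\<lambda>n. f (p @ [n])) summable_on {last p..}"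
    and "(\<lambda>p. \<Sum>\<^sub>\<infinity>n\<in>{last p..}. f (p @ [n])) summable_on sorted_lists (Suc N)"
    and "(\<Sum>\<^sub>\<infinity>p\<in>sorted_lists (Suc N). \<Sum>\<^sub>\<infinity>n\<in>{last p..}. f (p @ [n])) = infsum f (sorted_lists (Suc (Suc N)))"
proof -
  have sum: "(\<lambda>z. f (case z of (p, n) \<Rightarrow> p @ [n])) summable_on Sigma (sorted_lists (Suc N)) (\<lambda>p. {last p..})"
    unfolding summable_on_reindex_bij_betw[OF sorted_lists_snoc_bij] by (rule assms)
  then have sum': "(\<lambda>(p, n). f (p @ [n])) summable_on Sigma (sorted_lists (Suc N)) (\<lambda>p. {last p..})"
    by (simp add: case_prod_unfold)
  show "(\<lambda>n. f (p @ [n])) summable_on {last p..}" if "p \<in> sorted_lists (Suc N)"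
    using summable_on_SigmaD1[OF sum' that] .
  show "(\<lambda>p. \<Sum>\<^sub>\<infinity>n\<in>{last p..}. f (p @ [n])) summable_on sorted_lists (Suc N)"
    by (rule summable_on_Sigma_banach[OF sum'])
  show "(\<Sum>\<^sub>\<infinity>p\<in>sorted_lists (Suc N). \<Sum>\<^sub>\<infinity>n\<in>{last p..}. f (p @ [n])) = infsum f (sorted_lists (Suc (Suc N)))"
    using infsum_Sigma_banach[OF sum] infsum_reindex_bij_betw[OF sorted_lists_snoc_bij, of f N] by simp
qed

lemma sorted_lists_constant:
  assumes "l \<in> sorted_lists (Suc N)" "hd l = last l"
  shows "l = replicate (Suc N) (hd l)"
proof (rule replicate_eqI)
  fix y assume "y \<in> set l"
  then obtain i where i: "i < length l" "y = l ! i"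
    by (auto simp: in_set_conv_nth)
  have l: "l \<noteq> []" "sorted l"
    using assms by (auto simp: sorted_lists_def)
  then have "hd l \<le> y" "y \<le> last l"
    unfolding hd_conv_nth[OF l(1)] last_conv_nth[OF l(1)] i(2)
    using i(1) by (auto intro!: sorted_nth_mono)
  with assms(2) show "y = hd l" by simp
qed (use assms in \<open>auto simp: sorted_lists_def\<close>)

text \<open>If the first and last variables agree, so do all others, and this part of a multiple
  series is a single series. Every \<open>Z\<close> in the final formula arises in this way.\<close>

lemma infsum_diagonal:
  fixes f :: "nat list \<Rightarrow> complex"
  shows "(\<Sum>\<^sub>\<infinity>l\<in>sorted_lists (Suc N). if hd l = last l then f l else 0) = (\<Sum>\<^sub>\<infinity>n. f (replicate (Suc N) n))"
proof -
  have const: "replicate (Suc N) (last l) = l" if "l \<in> sorted_lists (Suc N)" "hd l = last l" for l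
    using sorted_lists_constant[OF that] unfolding that(2) by (rule sym)
  have repl: "replicate (Suc N) n \<in> sorted_lists (Suc N)" for n
    by (simp add: sorted_lists_def del: replicate_Suc)
  have "(\<Sum>\<^sub>\<infinity>l\<in>sorted_lists (Suc N). if hd l = last l then f l else 0)
      = infsum f {l \<in> sorted_lists (Suc N). hd l = last l}"
    by (rule infsum_cong_neutral) auto
  also have "\<dots> = (\<Sum>\<^sub>\<infinity>n. f (replicate (Suc N) n))"
    by (rule infsum_reindex_bij_witness[where i = "replicate (Suc N)" and j = hd])
      (auto simp: const repl simp del: replicate_Suc)
  finally show ?thesis .
qed

section \<open>Geometric sums and index lists\<close>

text \<open>For m different from n, the relation p q (n - m) = p - q combines with the factorization
  of \<open>p ^ K - q ^ K\<close>. For m = n all K summands coincide, and both quotients are zero by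
  division by zero.\<close>

lemma geometric_difference:
  fixes a b :: complex and m n :: nat
  defines "p \<equiv> 1 / (of_nat m + a)" and "q \<equiv> 1 / (of_nat n + a)"
  assumes "of_nat m + a \<noteq> 0" "of_nat n + a \<noteq> 0"
  shows "(\<Sum>j<K. p ^ (j + 1) * q ^ (K - j)) = p ^ K / (of_nat n - of_nat m) - q ^ K / (of_nat n - of_nat m)
    + (if m = n then of_nat K * p ^ (K + 1) else 0)"
proof (cases "m = n")
  case True
  have "(\<Sum>j<K. p ^ (j + 1) * p ^ (K - j)) = (\<Sum>j<K. p ^ (K + 1))"
    by (rule sum.cong) (simp_all flip: power_add)
  with True show ?thesis by (simp add: p_def q_def)
next
  case False
  then have nz: "(of_nat n - of_nat m :: complex) \<noteq> 0"
    by simp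
  have "(\<Sum>j<K. p ^ (j + 1) * q ^ (K - j)) = p * q * (\<Sum>j<K. p ^ j * q ^ (K - Suc j))"
    unfolding sum_distrib_left
  proof (rule sum.cong)
    fix j assume "j \<in> {..<K}"
    then have "K - j = Suc (K - Suc j)" by auto
    then show "p ^ (j + 1) * q ^ (K - j) = p * q * (p ^ j * q ^ (K - Suc j))"
      by simp
  qed simp
  moreover have "p * q * (of_nat n - of_nat m) = p - q"
    using assms by (simp add: p_def q_def field_simps)
  moreover have "(p - q) * (\<Sum>j<K. p ^ j * q ^ (K - Suc j)) = p ^ K - q ^ K"
    by (simp add: power_diff_sumr2 mult.commute)
  ultimately have "(\<Sum>j<K. p ^ (j + 1) * q ^ (K - j)) * (of_nat n - of_nat m) = p ^ K - q ^ K"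
    by (metis (no_types, lifting) mult.assoc mult.commute)
  with nz have "(\<Sum>j<K. p ^ (j + 1) * q ^ (K - j)) = (p ^ K - q ^ K) / (of_nat n - of_nat m)"
    by (simp add: eq_divide_eq)
  with False show ?thesis by (simp add: diff_divide_distrib)
qed

lemma sum_list_ge:
  fixes ks :: "nat list"
  shows "\<forall>k\<in>set ks. k \<ge> 2 \<Longrightarrow> 2 * length ks \<le> sum_list ks"
  by (induction ks) auto

lemma sum_list_rotate: "sum_list (rotate n xs) = sum_list (xs :: nat list)"
proof (induction n)
  case (Suc n)
  moreover have "sum_list (rotate1 ys) = sum_list ys" for ys :: "nat list"
    by (cases ys) simp_all
  ultimately show ?case by simp
qed simp

subsection \<open>The telescoping identity\<close>

locale hyp_params =
  fixes \<alpha> \<beta> \<gamma> t :: complex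
  assumes t_eq: "t = \<alpha> + \<beta> - \<gamma>"
    and Re_t_pos: "Re t > 0"
    and \<alpha>: "\<alpha> \<notin> \<int>\<^sub>\<le>\<^sub>0" and \<beta>: "\<beta> \<notin> \<int>\<^sub>\<le>\<^sub>0" and \<gamma>: "\<gamma> \<notin> \<int>\<^sub>\<le>\<^sub>0"
begin

abbreviation w :: "nat \<Rightarrow> complex" where "w \<equiv> hyp_weight \<alpha> \<beta> \<gamma>"
abbreviation v :: "nat \<Rightarrow> complex" where "v \<equiv> hyp_weight_inv \<alpha> \<beta> \<gamma>"

definition s :: "nat \<Rightarrow> complex" where "s n = w n * ((of_nat n + \<alpha>) * (of_nat n + \<beta>))"
definition u :: "nat \<Rightarrow> complex" where "u n = v n / ((of_nat n + \<alpha>) * (of_nat n + \<beta>))"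

lemma shift_nonzero [simp]:
  "of_nat n + \<alpha> \<noteq> 0" "of_nat n + \<beta> \<noteq> 0" "of_nat n + \<gamma> \<noteq> 0"
  "\<alpha> + of_nat n \<noteq> 0" "\<beta> + of_nat n \<noteq> 0" "\<gamma> + of_nat n \<noteq> 0"
  using \<alpha> \<beta> \<gamma> plus_of_nat_eq_0_imp[of _ n] by (auto simp: add.commute)

lemma pochhammer_nonzero [simp]:
  "pochhammer \<alpha> n \<noteq> 0" "pochhammer \<beta> n \<noteq> 0" "pochhammer \<gamma> n \<noteq> 0"
  using \<alpha> \<beta> \<gamma> pochhammer_eq_0_imp_nonpos_Int by blast+

lemma v_eq_inverse: "v n = inverse (w n)"
  by (simp add: hyp_weight_def hyp_weight_inv_def)

lemma w_nonzero [simp]: "w n \<noteq> 0"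
  by (simp add: hyp_weight_def)

lemma w_v [simp]: "w n * v n = 1"
  by (simp add: v_eq_inverse)

lemma w_u: "w n * u n = 1 / ((of_nat n + \<alpha>) * (of_nat n + \<beta>))"
  using w_v[of n] by (simp add: u_def)

text \<open>The ratio of consecutive weights with denominators cleared. It allows \<open>s n\<close>
  to be read as a quantity attached to the index n + 1, which drives the telescoping in m.\<close>

lemma s_eq: "s n = w (Suc n) * ((of_nat n + \<gamma>) * of_nat (Suc n))"
  by (simp add: s_def hyp_weight_def pochhammer_Suc divide_simps add.commute del: of_nat_Suc)

lemma v_Suc: "v (Suc n) = u n * ((of_nat n + \<gamma>) * of_nat (Suc n))"
  by (simp add: u_def hyp_weight_inv_def pochhammer_Suc divide_simps add.commute del: of_nat_Suc)

lemma v_u: "v n = u n * ((of_nat n + \<alpha>) * (of_nat n + \<beta>))"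
  by (simp add: u_def)

text \<open>The summand in \<open>n\<close> on the left of the two-variable identity. At
  \<open>n = p\<close> the quotient is zero by division by zero.\<close>

definition G :: "nat \<Rightarrow> nat \<Rightarrow> complex" where
  "G p n = s p * u n / (of_nat n - of_nat p) + t * (\<Sum>m\<le>p. w m * u n)"

text \<open>Division by zero makes the term \<open>m = n\<close> vanish.\<close>

definition H :: "nat \<Rightarrow> nat \<Rightarrow> complex" where
  "H p n = (\<Sum>m\<le>p. w m * v n / (of_nat n - of_nat m))"

text \<open>Put z = n - m. Dividing (m + \<alpha>)(m + \<beta>) by z and (n + \<gamma>)(n + 1) by z
  + 1 leaves polynomial parts that are linear in m + n; the two differ by the constant \<alpha> +
  \<beta> - \<gamma>, which is exactly what the term with \<open>t\<close> compensates.\<close>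

lemma kernel_step:
  assumes "m < n"
  shows "w m * ((of_nat m + \<alpha>) * (of_nat m + \<beta>)) * u n / (of_nat n - of_nat m)
       - w m * ((of_nat m - 1 + \<gamma>) * of_nat m) * u n / (of_nat n - of_nat m + 1) + t * (w m * u n)
       = w m * v n / (of_nat n - of_nat m) - w m * v (Suc n) / (of_nat (Suc n) - of_nat m)"
proof -
  define x y z :: complex where "x = of_nat m" and "y = of_nat n" and "z = of_nat (n - m)"
  have y: "y = x + z" and nz: "z \<noteq> 0" "z + 1 \<noteq> 0"
    using assms of_nat_neq_0[of "n - m", where 'a = complex]
    by (auto simp: x_def y_def z_def of_nat_diff add.commute)
  have "(x + \<alpha>) * (x + \<beta>) = (y + \<alpha>) * (y + \<beta>) - z * (x + y + \<alpha> + \<beta>)"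
    by (simp add: y algebra_simps)
  then have 1: "(x + \<alpha>) * (x + \<beta>) / z = (y + \<alpha>) * (y + \<beta>) / z - (x + y + \<alpha> + \<beta>)"
    using nz by (simp only: diff_divide_distrib nonzero_mult_div_cancel_left not_False_eq_True)
  have "(y + \<gamma>) * (y + 1) = (x - 1 + \<gamma>) * x + (z + 1) * (x + y + \<gamma>)"
    by (simp add: y algebra_simps)
  then have 2: "(y + \<gamma>) * (y + 1) / (z + 1) = (x - 1 + \<gamma>) * x / (z + 1) + (x + y + \<gamma>)"
    using nz by (simp only: add_divide_distrib nonzero_mult_div_cancel_left not_False_eq_True)
  have "(x + \<alpha>) * (x + \<beta>) / z - (x - 1 + \<gamma>) * x / (z + 1) + t
      = (y + \<alpha>) * (y + \<beta>) / z - (y + \<gamma>) * (y + 1) / (z + 1)"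
    unfolding 1 2 t_eq by simp
  then have "(x + \<alpha>) * (x + \<beta>) / (y - x) - (x - 1 + \<gamma>) * x / (y - x + 1) + t
      = (y + \<alpha>) * (y + \<beta>) / (y - x) - (y + \<gamma>) * (y + 1) / (y - x + 1)"
    by (simp add: y)
  then have "w m * u n * ((x + \<alpha>) * (x + \<beta>) / (y - x) - (x - 1 + \<gamma>) * x / (y - x + 1) + t)
      = w m * u n * ((y + \<alpha>) * (y + \<beta>) / (y - x) - (y + \<gamma>) * (y + 1) / (y - x + 1))"
    by simp
  then show ?thesis
    unfolding v_u[of n] v_Suc x_def y_def by (simp add: algebra_simps)
qed

text \<open>This is \<open>kernel_step\<close> summed over m up to p: the subtracted quotient for m
  + 1 cancels the leading quotient for m, and the one for m = 0 vanishes through its factor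
  m.\<close>

lemma G_telescope_off_diagonal: "p < n \<Longrightarrow> G p n = H p n - H p (Suc n)"
proof (induction p)
  case 0
  then show ?case
    using kernel_step[of 0 n] by (simp add: G_def H_def s_def)
next
  case (Suc p)
  \<comment> \<open>The recurrence for the weight identifies the old quotient with the subtracted
    term of \<open>kernel_step\<close> at p + 1.\<close>
  have sp: "s p * u n / (of_nat n - of_nat p)
      = w (Suc p) * ((of_nat (Suc p) - 1 + \<gamma>) * of_nat (Suc p)) * u n / (of_nat n - of_nat (Suc p) + 1)"
    unfolding s_eq by simp
  have "G (Suc p) n = G p n + (s (Suc p) * u n / (of_nat n - of_nat (Suc p))
      - s p * u n / (of_nat n - of_nat p) + t * (w (Suc p) * u n))"
    by (simp add: G_def algebra_simps)
  also have "\<dots> = G p n + (w (Suc p) * v n / (of_nat n - of_nat (Suc p))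
      - w (Suc p) * v (Suc n) / (of_nat (Suc n) - of_nat (Suc p)))"
    unfolding sp s_def[of "Suc p"] kernel_step[OF Suc.prems] by (rule refl)
  also have "G p n = H p n - H p (Suc n)"
    using Suc by simp
  finally show ?case
    by (simp add: H_def)
qed

text \<open>Replaces \<open>kernel_step\<close> at m = n, where the quotients by n - m are omitted.
  The defect is the logarithmic derivative of (n + \<alpha>)(n + \<beta>) with respect to n.\<close>

lemma kernel_diagonal:
  "t * (w n * u n) = 1 / (of_nat n + \<alpha>) + 1 / (of_nat n + \<beta>) - w n * v (Suc n)
     + w n * u n * ((of_nat n - 1 + \<gamma>) * of_nat n)"
proof -
  have 1: "w n * v (Suc n) = w n * u n * ((of_nat n + \<gamma>) * (of_nat n + 1))"
    unfolding v_Suc by (simp add: algebra_simps)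
  have 2: "1 / (of_nat n + \<alpha>) + 1 / (of_nat n + \<beta>)
      = w n * u n * ((of_nat n + \<alpha>) + (of_nat n + \<beta>))"
    unfolding w_u by (simp add: add_divide_eq_iff divide_add_eq_iff algebra_simps)
  show ?thesis
    unfolding 1 2 t_eq by (simp add: algebra_simps)
qed

lemma G_telescope_diagonal:
  "G p p = H p p - H p (Suc p) + 1 / (of_nat p + \<alpha>) + 1 / (of_nat p + \<beta>)"
proof (cases p)
  case 0
  then show ?thesis
    using kernel_diagonal[of 0] by (simp add: G_def H_def)
next
  case (Suc q)
  have "s q * u p = w p * u p * ((of_nat p - 1 + \<gamma>) * of_nat p)"
    unfolding s_eq Suc by simp
  \<comment> \<open>Here p - q = 1, so the quotient in \<open>G q p\<close> is
    \<open>s q * u p\<close> itself, while the quotient in \<open>G p p\<close> is zero.\<close>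
  then have "G p p = G q p + (1 / (of_nat p + \<alpha>) + 1 / (of_nat p + \<beta>) - w p * v (Suc p))"
    using kernel_diagonal[of p] by (simp add: G_def Suc algebra_simps)
  also have "G q p = H q p - H q (Suc p)"
    by (rule G_telescope_off_diagonal) (simp add: Suc)
  finally show ?thesis
    by (simp add: H_def Suc)
qed

lemma G_telescope:
  assumes "p \<le> n"
  shows "G p n = H p n - H p (Suc n)
           + (if n = p then 1 / (of_nat p + \<alpha>) + 1 / (of_nat p + \<beta>) else 0)"
  using assms G_telescope_diagonal[of p] G_telescope_off_diagonal[of p n] by auto

subsection \<open>Growth bounds and summability\<close>

text \<open>The weight is, up to a power of n, a quotient of the sequences in the limit formula for
  the Gamma function.\<close>

lemma w_asymp:
  "(\<lambda>n. w n * exp ((1 - t) * of_real (ln (real n)))) \<longlonglongrightarrow> Gamma \<gamma> / (Gamma \<alpha> * Gamma \<beta>)"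
proof -
  have "(\<lambda>n. Gamma_series' \<gamma> n / (Gamma_series' \<alpha> n * Gamma_series' \<beta> n))
          \<longlonglongrightarrow> Gamma \<gamma> / (Gamma \<alpha> * Gamma \<beta>)"
    using \<alpha> \<beta> by (intro tendsto_intros Gamma_series'_LIMSEQ) (auto simp: Gamma_eq_zero_iff)
  moreover have "\<forall>\<^sub>F n in sequentially. Gamma_series' \<gamma> n / (Gamma_series' \<alpha> n * Gamma_series' \<beta> n)
      = w n * exp ((1 - t) * of_real (ln (real n)))"
    using eventually_gt_at_top[of 0]
  proof eventually_elim
    case (elim n)
    define L :: complex where "L = of_real (ln (real n))"
    have "exp ((1 - t) * L) * exp (\<alpha> * L) * exp (\<beta> * L) = exp L * exp (\<gamma> * L)"
      unfolding exp_add[symmetric] by (simp add: t_eq algebra_simps)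
    moreover have "exp L = of_nat n"
      using elim by (simp add: L_def exp_of_real)
    \<comment> \<open>The extra factor n turns the factorial of n - 1 in
      \<open>Gamma_series'\<close> into the \<open>fact n\<close> of the weight.\<close>
    ultimately have E: "exp ((1 - t) * L) = of_nat n * exp (\<gamma> * L) / (exp (\<alpha> * L) * exp (\<beta> * L))"
      by (simp add: field_simps)
    have "fact n = of_nat n * (fact (n - 1) :: complex)"
      using elim by (simp add: fact_reduce)
    then show ?case
      unfolding L_def[symmetric] Gamma_series'_def hyp_weight_def E
      using elim by (simp add: mult_ac)
  qed
  ultimately show ?thesis
    by (rule Lim_transform_eventually)
qed

text \<open>The limit in \<open>w_asymp\<close> is nonzero, so the normalized norm \<open>f\<close>
  and its inverse are both bounded. Passing from n to n + 1 in the power, which keeps the bounds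
  valid at n = 0, costs a factor that tends to 1.\<close>

lemma weight_bounds:
  obtains C where "C > 0" "\<And>n. norm (w n) \<le> C * (real n + 1) powr (Re t - 1)"
    "\<And>n. norm (v n) \<le> C * (real n + 1) powr (1 - Re t)"
proof -
  define L where "L = Gamma \<gamma> / (Gamma \<alpha> * Gamma \<beta>)"
  have L: "norm L \<noteq> 0"
    using \<alpha> \<beta> \<gamma> by (simp add: L_def Gamma_eq_zero_iff)
  define f where "f n = norm (w n) * (real n + 1) powr (1 - Re t)" for n
  have "(\<lambda>n. ln (1 + inverse (real n))) \<longlonglongrightarrow> ln (1 + 0)"
    by (intro tendsto_intros lim_inverse_n) auto
  moreover have "\<forall>\<^sub>F n in sequentially. ln (1 + inverse (real n)) = ln (real n + 1) - ln (real n)"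
    using eventually_gt_at_top[of 0]
  proof eventually_elim
    case (elim n)
    then have "1 + inverse (real n) = (real n + 1) / real n"
      by (simp add: field_simps)
    then show ?case
      using elim by (simp add: ln_div)
  qed
  ultimately have "(\<lambda>n. ln (real n + 1) - ln (real n)) \<longlonglongrightarrow> 0"
    using Lim_transform_eventually by fastforce
  then have "(\<lambda>n. exp ((1 - Re t) * (ln (real n + 1) - ln (real n)))) \<longlonglongrightarrow> exp ((1 - Re t) * 0)"
    by (intro tendsto_intros)
  then have "(\<lambda>n. exp ((1 - Re t) * (ln (real n + 1) - ln (real n)))) \<longlonglongrightarrow> 1"
    by simp
  from tendsto_mult[OF tendsto_norm[OF w_asymp] this]
  have "(\<lambda>n. norm (w n * exp ((1 - t) * of_real (ln (real n)))) *
      exp ((1 - Re t) * (ln (real n + 1) - ln (real n)))) \<longlonglongrightarrow> norm L"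
    by (simp add: L_def)
  \<comment> \<open>Valid for n = 0 too: the two occurrences of \<open>ln (real n)\<close> cancel
    whatever the value of \<open>ln 0\<close>.\<close>
  moreover have "norm (w n * exp ((1 - t) * of_real (ln (real n)))) *
      exp ((1 - Re t) * (ln (real n + 1) - ln (real n))) = f n" for n
    by (simp add: f_def norm_mult powr_def mult.assoc right_diff_distrib flip: exp_add)
  ultimately have lim: "f \<longlonglongrightarrow> norm L"
    by simp
  then have "Bseq f"
    by (intro convergent_imp_Bseq) (auto simp: convergent_def)
  then obtain C1 where C1: "C1 > 0" "\<And>n. norm (f n) \<le> C1"
    by (auto simp: Bseq_def)
  have "(\<lambda>n. inverse (f n)) \<longlonglongrightarrow> inverse (norm L)"
    using lim L by (rule tendsto_inverse)
  then have "Bseq (\<lambda>n. inverse (f n))"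
    by (intro convergent_imp_Bseq) (auto simp: convergent_def)
  then obtain C2 where C2: "C2 > 0" "\<And>n. norm (inverse (f n)) \<le> C2"
    by (auto simp: Bseq_def)
  have f_nonneg: "f n \<ge> 0" for n
    by (simp add: f_def)
  have "norm (w n) = f n * (real n + 1) powr (Re t - 1)" for n
    using powr_add[of "real n + 1" "1 - Re t" "Re t - 1"] by (simp add: f_def)
  then have w: "norm (w n) \<le> max C1 C2 * (real n + 1) powr (Re t - 1)" for n
    using C1(2)[of n] by (auto intro!: mult_right_mono)
  have "norm (v n) = inverse (f n) * (real n + 1) powr (1 - Re t)" for n
    by (simp add: f_def v_eq_inverse norm_inverse norm_divide field_simps)
  then have v: "norm (v n) \<le> max C1 C2 * (real n + 1) powr (1 - Re t)" for n
    using C2(2)[of n] f_nonneg[of n] by (auto intro!: mult_right_mono simp: le_max_iff_disj)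
  show thesis
    by (rule that[of "max C1 C2"]) (use C1 w v in auto)
qed

section \<open>Factors and products of the multiple series\<close>

definition P :: "nat \<Rightarrow> nat \<Rightarrow> complex" where
  "P k n = 1 / ((of_nat n + \<alpha>) * (of_nat n + \<beta>) * (of_nat n + \<gamma>) powi (int k - 2))"

definition x :: "nat \<Rightarrow> complex" where "x n = 1 / (of_nat n + \<gamma>)"

definition chain :: "nat list \<Rightarrow> nat list \<Rightarrow> complex" where
  "chain ks p = prod_list (map2 P ks p)"

lemma chain_Nil [simp]: "chain [] p = 1"
  and chain_Cons [simp]: "chain (k # ks) (n # p) = P k n * chain ks p"
  by (simp_all add: chain_def)

lemma chain_snoc [simp]: "length ks = length p \<Longrightarrow> chain (ks @ [k]) (p @ [n]) = chain ks p * P k n"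
  by (simp add: chain_def)

lemma P_eq: "k \<ge> 2 \<Longrightarrow> P k n = x n ^ (k - 2) / ((of_nat n + \<alpha>) * (of_nat n + \<beta>))"
  by (simp add: P_def x_def power_int_def nat_diff_distrib power_one_over field_simps)

lemma x_bound:
  obtains C where "C > 0" "\<And>n. norm (x n ^ i) \<le> C * (real n + 1) powr (- real i)"
  using inverse_power_bound[OF \<gamma>] unfolding x_def by blast

lemma P_bound:
  assumes "k \<ge> 2"
  obtains C where "C > 0" "\<And>n. norm (P k n) \<le> C * (real n + 1) powr (- real k)"
proof -
  obtain C1 where C1: "C1 > 0" "\<And>n. norm (x n ^ (k - 2)) \<le> C1 * (real n + 1) powr (- real (k - 2))"
    using x_bound by blast
  obtain C2 where C2: "C2 > 0" "\<And>n::nat. norm (1 / (of_nat n + \<alpha>)) \<le> C2 * (real n + 1) powr -1"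
    using inverse_shift_bound[OF \<alpha>] by blast
  obtain C3 where C3: "C3 > 0" "\<And>n::nat. norm (1 / (of_nat n + \<beta>)) \<le> C3 * (real n + 1) powr -1"
    using inverse_shift_bound[OF \<beta>] by blast
  have "norm (P k n) \<le> C1 * C2 * C3 * (real n + 1) powr (- real k)" for n
  proof -
    have "norm (P k n) = norm (x n ^ (k - 2)) * norm (1 / (of_nat n + \<alpha>)) * norm (1 / (of_nat n + \<beta>))"
      by (simp add: P_eq[OF assms] norm_mult norm_divide)
    also have "\<dots> \<le> (C1 * (real n + 1) powr (- real (k - 2))) * (C2 * (real n + 1) powr -1)
        * (C3 * (real n + 1) powr -1)"
      by (intro mult_mono C1 C2 C3) (use C1 C2 C3 in auto)
    also have "\<dots> = C1 * C2 * C3 * ((real n + 1) powr (- real (k - 2)) * (real n + 1) powr -1 * (real n + 1) powr -1)"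
      by (simp only: mult_ac)
    also have "(real n + 1) powr (- real (k - 2)) * (real n + 1) powr -1 * (real n + 1) powr -1
        = (real n + 1) powr (- real k)"
      unfolding powr_add[symmetric] using assms by (simp add: of_nat_diff)
    finally show ?thesis .
  qed
  with C1 C2 C3 that[of "C1 * C2 * C3"] show thesis by simp
qed

lemma chain_bound:
  assumes "\<forall>k\<in>set ks. k \<ge> 2"
  obtains C where "C > 0" "\<And>p. length p = length ks \<Longrightarrow>
    norm (chain ks p) \<le> C * prod_list (map (\<lambda>n. (real n + 1) powr -2) p)"
proof -
  have "\<exists>C>0. \<forall>p. length p = length ks \<longrightarrow>
      norm (chain ks p) \<le> C * prod_list (map (\<lambda>n. (real n + 1) powr -2) p)"
    using assms
  proof (induction ks)
    case Nil
    then show ?case by (auto intro!: exI[of _ 1])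
  next
    case (Cons k ks)
    then obtain C1 where C1: "C1 > 0" "\<And>p. length p = length ks \<Longrightarrow>
        norm (chain ks p) \<le> C1 * prod_list (map (\<lambda>n. (real n + 1) powr -2) p)"
      by auto
    obtain C2 where C2: "C2 > 0" "\<And>n. norm (P k n) \<le> C2 * (real n + 1) powr (- real k)"
      using P_bound[of k] Cons.prems by auto
    have P: "norm (P k n) \<le> C2 * (real n + 1) powr -2" for n
    proof -
      have "(real n + 1) powr (- real k) \<le> (real n + 1) powr -2"
        by (rule powr_mono) (use Cons.prems in auto)
      with C2(1) C2(2)[of n] show ?thesis
        by (meson mult_left_mono less_imp_le order_trans)
    qed
    have "norm (chain (k # ks) p) \<le> C2 * C1 * prod_list (map (\<lambda>n. (real n + 1) powr -2) p)"
      if p: "length p = length (k # ks)" for p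
    proof -
      obtain n p' where p': "p = n # p'" "length p' = length ks"
        using p by (auto simp: length_Suc_conv)
      have "norm (P k n) * norm (chain ks p')
          \<le> (C2 * (real n + 1) powr -2) * (C1 * prod_list (map (\<lambda>n. (real n + 1) powr -2) p'))"
        by (intro mult_mono P C1 p') (use C2 in auto)
      then show ?thesis by (simp add: p' norm_mult mult_ac)
    qed
    with C1 C2 show ?case by (intro exI[of _ "C2 * C1"]) auto
  qed
  with that show thesis by blast
qed

text \<open>As m is at most n, the power Re t - \<delta> of m + 1 may be traded for the same power
  of n + 1, which cancels against the decay of \<open>v n\<close>. The value 0 for \<delta> favours
  the small variable, and a small positive value leaves extra decay in n.\<close>

lemma weight_pair_bound:
  assumes "k \<ge> 2" "0 \<le> \<delta>" "\<delta> \<le> Re t"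
  obtains C where "C > 0" "\<And>m n. m \<le> n \<Longrightarrow> norm (w m * v n * x m ^ i * P k n)
     \<le> C * ((real m + 1) powr (\<delta> - 1 - real i) * (real n + 1) powr (1 - \<delta> - real k))"
proof -
  obtain C1 where C1: "C1 > 0" "\<And>n. norm (w n) \<le> C1 * (real n + 1) powr (Re t - 1)"
    "\<And>n. norm (v n) \<le> C1 * (real n + 1) powr (1 - Re t)"
    using weight_bounds by blast
  obtain C2 where C2: "C2 > 0" "\<And>n. norm (x n ^ i) \<le> C2 * (real n + 1) powr (- real i)"
    using x_bound by blast
  obtain C3 where C3: "C3 > 0" "\<And>n. norm (P k n) \<le> C3 * (real n + 1) powr (- real k)"
    using P_bound[OF assms(1)] by blast
  have "norm (w m * v n * x m ^ i * P k n) \<le> C1 * C1 * C2 * C3 *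
      ((real m + 1) powr (\<delta> - 1 - real i) * (real n + 1) powr (1 - \<delta> - real k))"
    if "m \<le> n" for m n
  proof -
    have "norm (w m * v n * x m ^ i * P k n) = norm (w m) * norm (v n) * norm (x m ^ i) * norm (P k n)"
      by (simp add: norm_mult)
    also have "\<dots> \<le> (C1 * (real m + 1) powr (Re t - 1)) * (C1 * (real n + 1) powr (1 - Re t))
        * (C2 * (real m + 1) powr (- real i)) * (C3 * (real n + 1) powr (- real k))"
      by (intro mult_mono C1 C2 C3) (use C1 C2 C3 in auto)
    also have "\<dots> = C1 * C1 * C2 * C3 * (((real m + 1) powr (Re t - 1) * (real m + 1) powr (- real i))
        * ((real n + 1) powr (1 - Re t) * (real n + 1) powr (- real k)))"
      by (simp only: mult_ac)
    also have "(real m + 1) powr (Re t - 1) * (real m + 1) powr (- real i)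
        = (real m + 1) powr (Re t - \<delta>) * (real m + 1) powr (\<delta> - 1 - real i)"
      unfolding powr_add[symmetric] by (simp add: algebra_simps)
    also have "(real n + 1) powr (1 - Re t) * (real n + 1) powr (- real k)
        = (real n + 1) powr (\<delta> - Re t) * (real n + 1) powr (1 - \<delta> - real k)"
      unfolding powr_add[symmetric] by (simp add: algebra_simps)
    also have "C1 * C1 * C2 * C3 * ((real m + 1) powr (Re t - \<delta>) * (real m + 1) powr (\<delta> - 1 - real i)
        * ((real n + 1) powr (\<delta> - Re t) * (real n + 1) powr (1 - \<delta> - real k)))
        \<le> C1 * C1 * C2 * C3 * ((real n + 1) powr (Re t - \<delta>) * (real m + 1) powr (\<delta> - 1 - real i)
        * ((real n + 1) powr (\<delta> - Re t) * (real n + 1) powr (1 - \<delta> - real k)))"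
      using that assms C1 C2 C3 by (intro mult_left_mono mult_right_mono powr_mono2) auto
    also have "\<dots> = C1 * C1 * C2 * C3 * (((real n + 1) powr (Re t - \<delta>) * (real n + 1) powr (\<delta> - Re t))
        * ((real m + 1) powr (\<delta> - 1 - real i) * (real n + 1) powr (1 - \<delta> - real k)))"
      by (simp only: mult_ac)
    also have "(real n + 1) powr (Re t - \<delta>) * (real n + 1) powr (\<delta> - Re t) = 1"
      unfolding powr_add[symmetric] by simp
    finally show ?thesis by simp
  qed
  with C1 C2 C3 that[of "C1 * C1 * C2 * C3"] show thesis by simp
qed

section \<open>The star series as sums over sorted lists\<close>

lemma chain_eq_prod:
  "length ks = length p \<Longrightarrow> chain ks p = (\<Prod>i<length p. P (ks ! i) (p ! i))"
  by (simp add: chain_def prod.list_conv_set_nth lessThan_atLeast0)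

lemma Z_I_star_eq:
  "Z_I_star (k # ks) \<alpha> \<beta> \<gamma>
     = (\<Sum>\<^sub>\<infinity>l\<in>sorted_lists (Suc (length ks)). w (hd l) * v (last l) * x (hd l) ^ k * chain ks (tl l))"
  unfolding Z_I_star_def sorted_lists_def length_Cons
proof (rule infsum_cong)
  fix l :: "nat list" assume "l \<in> {m. length m = Suc (length ks) \<and> sorted m}"
  then obtain m p where l: "l = m # p" "length p = length ks"
    by (auto simp: length_Suc_conv)
  \<comment> \<open>The product starts at the second variable, so index \<open>i\<close> of the
    definition is index \<open>i - 2\<close> in the tails.\<close>
  have "(\<Prod>i = 2..Suc (length ks). P ((k # ks) ! (i - 1)) (l ! (i - 1))) = (\<Prod>i<length p. P (ks ! i) (p ! i))"
    by (rule prod.reindex_bij_witness[of _ "\<lambda>i. i + 2" "\<lambda>i. i - 2"])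
      (auto simp: l nth_Cons' numeral_2_eq_2)
  then show "w (hd l) * v (last l) * (1 / (of_nat (hd l) + \<gamma>) ^ hd (k # ks)) *
      (\<Prod>i = 2..Suc (length ks). 1 / ((of_nat (l ! (i - 1)) + \<alpha>) * (of_nat (l ! (i - 1)) + \<beta>) *
        (of_nat (l ! (i - 1)) + \<gamma>) powi (int ((k # ks) ! (i - 1)) - 2)))
      = w (hd l) * v (last l) * x (hd l) ^ k * chain ks (tl l)"
    unfolding P_def[symmetric] by (simp add: l chain_eq_prod x_def power_one_over)
qed

lemma Z_II_star_eq:
  "Z_II_star ks \<alpha> \<beta> \<gamma> = (\<Sum>\<^sub>\<infinity>l\<in>sorted_lists (Suc (length ks)). w (hd l) * v (last l) * chain ks (tl l))"
  unfolding Z_II_star_def sorted_lists_def Suc_eq_plus1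
proof (rule infsum_cong)
  fix l :: "nat list" assume "l \<in> {m. length m = length ks + 1 \<and> sorted m}"
  then obtain m p where l: "l = m # p" "length p = length ks"
    by (auto simp: length_Suc_conv)
  have "(\<Prod>i = 1..length ks. P (ks ! (i - 1)) (l ! i)) = (\<Prod>i<length p. P (ks ! i) (p ! i))"
    by (rule prod.reindex_bij_witness[of _ "\<lambda>i. i + 1" "\<lambda>i. i - 1"])
      (auto simp: l nth_Cons')
  then show "w (hd l) * v (last l) *
      (\<Prod>i = 1..length ks. 1 / ((of_nat (l ! i) + \<alpha>) * (of_nat (l ! i) + \<beta>) *
        (of_nat (l ! i) + \<gamma>) powi (int (ks ! (i - 1)) - 2)))
      = w (hd l) * v (last l) * chain ks (tl l)"
    unfolding P_def[symmetric] by (simp add: l chain_eq_prod)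
qed

text \<open>The product covers all variables but the last, which is the extra one and carries only
  \<open>u\<close>. This is the first half of the geometric difference, since
  \<open>s m * P k m\<close> is \<open>w m\<close> times a power of \<open>x m\<close>.\<close>

definition head_term :: "nat list \<Rightarrow> nat list \<Rightarrow> complex" where
  "head_term ks l = s (hd l) * u (last l) / (of_nat (last l) - of_nat (hd l)) * chain ks (butlast l)"

text \<open>The mirror image: the first variable is the extra one and carries only
  \<open>w\<close>.\<close>

definition tail_term :: "nat list \<Rightarrow> nat list \<Rightarrow> complex" where
  "tail_term ks l = w (hd l) * v (last l) / (of_nat (last l) - of_nat (hd l)) * chain ks (tl l)"

lemma u_eq: "u n = v n * P 2 n"
  by (simp add: u_def P_def)

lemma s_P: "k \<ge> 2 \<Longrightarrow> s m * P k m = w m * x m ^ (k - 2)"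
  by (simp add: s_def P_eq)

section \<open>Absolute convergence of the multiple series\<close>

text \<open>Common form of head and tail terms. With \<delta> = 0 the outer factors are bounded by a
  multiple of 1 / ((m + 1)(n + 1)), and dividing by n - m gives the majorant of
  \<open>summable_on_kernel\<close>.\<close>

lemma summable_kernel_framed:
  assumes ks: "\<forall>k\<in>set ks. k \<ge> 2" and k: "k \<ge> 2"
    and f: "\<And>m mid n. length mid = length ks \<Longrightarrow> f (m # mid @ [n])
      = (w m * v n * x m ^ i * P k n) / (of_nat n - of_nat m) * chain ks mid"
  shows "f summable_on sorted_lists (Suc (Suc (length ks)))"
proof (rule abs_summable_summable)
  obtain C1 where C1: "C1 > 0" "\<And>p. length p = length ks \<Longrightarrow>
      norm (chain ks p) \<le> C1 * prod_list (map (\<lambda>n. (real n + 1) powr -2) p)"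
    using chain_bound[OF ks] by blast
  obtain C2 where C2: "C2 > 0" "\<And>m n. m \<le> n \<Longrightarrow> norm (w m * v n * x m ^ i * P k n)
      \<le> C2 * ((real m + 1) powr (0 - 1 - real i) * (real n + 1) powr (1 - 0 - real k))"
    using weight_pair_bound[OF k, of 0 i] Re_t_pos by auto
  show "(\<lambda>l. norm (f l)) summable_on sorted_lists (Suc (Suc (length ks)))"
  proof (rule abs_summable_on_framed[OF summable_on_kernel, where g = "\<lambda>n. (real n + 1) powr -2" and C = "C2 * C1"])
    show "(\<lambda>n. (real n + 1) powr - 2) summable_on (UNIV :: nat set)"
      by (rule summable_on_powr) simp
    fix m n :: nat and mid :: "nat list"
    assume mid: "length mid = length ks" and "sorted (m # mid @ [n])"
    then have mn: "m \<le> n" by simp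
    have "norm (w m * v n * x m ^ i * P k n)
        \<le> C2 * ((real m + 1) powr (0 - 1 - real i) * (real n + 1) powr (1 - 0 - real k))"
      by (rule C2(2)[OF mn])
    also have "\<dots> \<le> C2 * ((real m + 1) powr -1 * (real n + 1) powr -1)"
      using C2(1) k by (intro mult_left_mono mult_mono powr_mono) auto
    finally have "norm (w m * v n * x m ^ i * P k n) \<le> C2 * (1 / ((real m + 1) * (real n + 1)))"
      by (simp add: powr_minus_divide)
    moreover have "norm (of_nat n - of_nat m :: complex) = real n - real m"
      using mn by (metis norm_of_nat of_nat_diff)
    ultimately have "norm ((w m * v n * x m ^ i * P k n) / (of_nat n - of_nat m))
        \<le> C2 * (1 / ((real m + 1) * (real n + 1))) / (real n - real m)"
      unfolding norm_divide using mn by (metis divide_right_mono diff_ge_0_iff_ge of_nat_le_iff)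
    then have "norm (f (m # mid @ [n])) \<le> C2 * (1 / ((real m + 1) * (real n + 1))) / (real n - real m)
        * (C1 * prod_list (map (\<lambda>n. (real n + 1) powr -2) mid))"
      unfolding f[OF mid] norm_mult[of _ "chain ks mid"] using C1 C2 mid mn
      by (intro mult_mono) auto
    then show "norm (f (m # mid @ [n])) \<le> C2 * C1 * (1 / ((real m + 1) * (real n + 1) * (real n - real m))
        * prod_list (map (\<lambda>n. (real n + 1) powr -2) mid))"
      by (simp add: mult_ac)
  qed auto
qed

lemma head_term_summable:
  assumes "\<forall>k\<in>set (k # ks). k \<ge> 2"
  shows "head_term (k # ks) summable_on sorted_lists (Suc (Suc (length ks)))"
\<comment> \<open>At the last variable \<open>u\<close> supplies the factor \<open>P 2\<close>; at
  the first, \<open>s\<close> turns \<open>P k\<close> into a power of \<open>x\<close>.\<close>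
proof (rule summable_kernel_framed[of _ 2 _ "k - 2"])
  fix m n :: nat and mid :: "nat list" assume "length mid = length ks"
  have "head_term (k # ks) (m # mid @ [n])
      = (s m * P k m) * (v n * P 2 n) / (of_nat n - of_nat m) * chain ks mid"
    by (simp add: head_term_def butlast_append u_eq mult_ac)
  then show "head_term (k # ks) (m # mid @ [n])
      = w m * v n * x m ^ (k - 2) * P 2 n / (of_nat n - of_nat m) * chain ks mid"
    using assms by (simp add: s_P mult_ac)
qed (use assms in auto)

lemma tail_term_summable:
  assumes "\<forall>k\<in>set (k # ks). k \<ge> 2"
  shows "tail_term (ks @ [k]) summable_on sorted_lists (Suc (Suc (length ks)))"
  by (rule summable_kernel_framed[of _ k _ 0])
    (use assms in \<open>auto simp: tail_term_def mult_ac\<close>)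

text \<open>With \<delta> = 0, the bounds on \<open>j\<close> and \<open>k\<close> give exponent at
  most -2 for both outer variables, so no kernel is involved.\<close>

lemma Z_I_star_summable:
  assumes ks: "\<forall>k\<in>set ks. k \<ge> 2" and k: "k \<ge> 3" and j: "j \<ge> 1"
  shows "(\<lambda>l. w (hd l) * v (last l) * x (hd l) ^ j * chain (ks @ [k]) (tl l))
    summable_on sorted_lists (Suc (Suc (length ks)))"
proof (rule abs_summable_summable)
  obtain C1 where C1: "C1 > 0" "\<And>p. length p = length ks \<Longrightarrow>
      norm (chain ks p) \<le> C1 * prod_list (map (\<lambda>n. (real n + 1) powr -2) p)"
    using chain_bound[OF ks] by blast
  obtain C2 where C2: "C2 > 0" "\<And>m n. m \<le> n \<Longrightarrow> norm (w m * v n * x m ^ j * P k n)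
      \<le> C2 * ((real m + 1) powr (0 - 1 - real j) * (real n + 1) powr (1 - 0 - real k))"
    using weight_pair_bound[of k 0 j] k Re_t_pos by auto
  show "(\<lambda>l. norm (w (hd l) * v (last l) * x (hd l) ^ j * chain (ks @ [k]) (tl l)))
      summable_on sorted_lists (Suc (Suc (length ks)))"
  proof (rule abs_summable_on_framed[OF summable_on_powr_pairs[of "-2"],
        where g = "\<lambda>n. (real n + 1) powr -2" and C = "C2 * C1"])
    show "(\<lambda>n. (real n + 1) powr - 2) summable_on (UNIV :: nat set)"
      by (rule summable_on_powr) simp
    fix m n :: nat and mid :: "nat list"
    assume mid: "length mid = length ks" and "sorted (m # mid @ [n])"
    then have mn: "m \<le> n" by simp
    have "norm (w m * v n * x m ^ j * P k n)
        \<le> C2 * ((real m + 1) powr (0 - 1 - real j) * (real n + 1) powr (1 - 0 - real k))"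
      by (rule C2(2)[OF mn])
    also have "\<dots> \<le> C2 * ((real m + 1) powr -2 * (real n + 1) powr -2)"
      using C2(1) k j by (intro mult_left_mono mult_mono powr_mono) auto
    finally have "norm (w m * v n * x m ^ j * P k n) * norm (chain ks mid)
        \<le> C2 * ((real m + 1) powr -2 * (real n + 1) powr -2)
          * (C1 * prod_list (map (\<lambda>n. (real n + 1) powr -2) mid))"
      using C1 C2 mid by (intro mult_mono) auto
    then show "norm (w (hd (m # mid @ [n])) * v (last (m # mid @ [n])) * x (hd (m # mid @ [n])) ^ j
        * chain (ks @ [k]) (tl (m # mid @ [n]))) \<le> C2 * C1 * ((real m + 1) powr -2 * (real n + 1) powr -2
        * prod_list (map (\<lambda>n. (real n + 1) powr -2) mid))"
      using mid by (simp add: norm_mult mult_ac)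
  qed auto
qed

text \<open>The weight alone leaves the exponent \<delta> - 1 for the first variable, too large for
  convergence. A power 2 \<delta> is moved to the next variable, which is at least as large and has
  decay to spare; \<open>ks\<close> being nonempty provides it.\<close>

lemma Z_II_star_summable:
  assumes ks: "\<forall>k\<in>set ks. k \<ge> 2" and "ks \<noteq> []"
  shows "(\<lambda>l. w (hd l) * v (last l) * chain (ks @ [2]) (tl l)) summable_on sorted_lists (Suc (Suc (length ks)))"
proof (rule abs_summable_summable)
  \<comment> \<open>Positivity makes both outer exponents -1 - \<delta> summable; the cap 1/4 keeps
    2 \<delta> - 2 below -1.\<close>
  define \<delta> where "\<delta> = min (Re t) (1 / 4)"
  have \<delta>: "0 < \<delta>" "\<delta> \<le> Re t" "\<delta> \<le> 1 / 4"
    using Re_t_pos by (auto simp: \<delta>_def)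
  obtain C1 where C1: "C1 > 0" "\<And>p. length p = length ks \<Longrightarrow>
      norm (chain ks p) \<le> C1 * prod_list (map (\<lambda>n. (real n + 1) powr -2) p)"
    using chain_bound[OF ks] by blast
  obtain C2 where C2: "C2 > 0" "\<And>m n. m \<le> n \<Longrightarrow> norm (w m * v n * x m ^ 0 * P 2 n)
      \<le> C2 * ((real m + 1) powr (\<delta> - 1 - real 0) * (real n + 1) powr (1 - \<delta> - real 2))"
    using weight_pair_bound[of 2 \<delta> 0] \<delta> by (auto simp del: power_0 of_nat_0)
  show "(\<lambda>l. norm (w (hd l) * v (last l) * chain (ks @ [2]) (tl l)))
      summable_on sorted_lists (Suc (Suc (length ks)))"
  proof (rule abs_summable_on_framed[OF summable_on_powr_pairs[of "-1 - \<delta>"],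
        where g = "\<lambda>n. (real n + 1) powr (2 * \<delta> - 2)" and C = "C2 * C1"])
    show "(\<lambda>n. (real n + 1) powr (2 * \<delta> - 2)) summable_on (UNIV :: nat set)"
      by (rule summable_on_powr) (use \<delta> in simp)
    fix m n :: nat and mid :: "nat list"
    assume mid: "length mid = length ks" and sorted: "sorted (m # mid @ [n])"
    then have mn: "m \<le> n" by simp
    obtain p mid' where p: "mid = p # mid'"
      using mid \<open>ks \<noteq> []\<close> by (cases mid) auto
    define R where "R e = prod_list (map (\<lambda>n. (real n + 1) powr e) mid')" for e
    have R: "0 \<le> R (-2)" "R (-2) \<le> R (2 * \<delta> - 2)"
      unfolding R_def by (induction mid') (use \<delta> in \<open>auto intro!: mult_mono powr_mono prod_list_nonneg\<close>)
    have "(real m + 1) powr (\<delta> - 1) = (real m + 1) powr (-1 - \<delta>) * (real m + 1) powr (2 * \<delta>)"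
      unfolding powr_add[symmetric] by simp
    also have "\<dots> \<le> (real m + 1) powr (-1 - \<delta>) * (real p + 1) powr (2 * \<delta>)"
      using sorted \<delta> by (intro mult_left_mono powr_mono2) (auto simp: p)
    finally have m: "(real m + 1) powr (\<delta> - 1) \<le> (real m + 1) powr (-1 - \<delta>) * (real p + 1) powr (2 * \<delta>)" .
    have pp: "(real p + 1) powr (2 * \<delta>) * (real p + 1) powr -2 = (real p + 1) powr (2 * \<delta> - 2)"
      unfolding powr_add[symmetric] by simp
    have "norm (w m * v n * P 2 n) \<le> C2 * ((real m + 1) powr (\<delta> - 1) * (real n + 1) powr (-1 - \<delta>))"
      using C2(2)[OF mn] by (simp add: algebra_simps)
    also have "\<dots> \<le> C2 * (((real m + 1) powr (-1 - \<delta>) * (real p + 1) powr (2 * \<delta>)) * (real n + 1) powr (-1 - \<delta>))"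
      using C2(1) m by (intro mult_left_mono mult_right_mono) auto
    finally have "norm (w m * v n * P 2 n) * norm (chain ks mid)
        \<le> C2 * (((real m + 1) powr (-1 - \<delta>) * (real p + 1) powr (2 * \<delta>)) * (real n + 1) powr (-1 - \<delta>))
          * (C1 * ((real p + 1) powr -2 * R (2 * \<delta> - 2)))"
    proof (rule mult_mono)
      have "norm (chain ks mid) \<le> C1 * ((real p + 1) powr -2 * R (-2))"
        using C1(2)[OF mid] by (simp add: R_def p)
      \<comment> \<open>The other middle variables are weakened to the exponent of \<open>p\<close>,
        since the comparison test uses one \<open>g\<close> for all of them.\<close>
      also have "\<dots> \<le> C1 * ((real p + 1) powr -2 * R (2 * \<delta> - 2))"
        using C1 R by (intro mult_left_mono) auto
      finally show "norm (chain ks mid) \<le> C1 * ((real p + 1) powr -2 * R (2 * \<delta> - 2))" .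
    qed (use C2 in auto)
    also have "\<dots> = C2 * C1 * ((real m + 1) powr (-1 - \<delta>) * (real n + 1) powr (-1 - \<delta>)
        * (((real p + 1) powr (2 * \<delta>) * (real p + 1) powr -2) * R (2 * \<delta> - 2)))"
      by (simp only: mult_ac)
    finally have "norm (w m * v n * P 2 n) * norm (chain ks mid)
        \<le> C2 * C1 * ((real m + 1) powr (-1 - \<delta>) * (real n + 1) powr (-1 - \<delta>)
        * ((real p + 1) powr (2 * \<delta> - 2) * R (2 * \<delta> - 2)))"
      unfolding pp .
    then show "norm (w (hd (m # mid @ [n])) * v (last (m # mid @ [n])) * chain (ks @ [2]) (tl (m # mid @ [n])))
        \<le> C2 * C1 * ((real m + 1) powr (-1 - \<delta>) * (real n + 1) powr (-1 - \<delta>)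
        * prod_list (map (\<lambda>n. (real n + 1) powr (2 * \<delta> - 2)) mid))"
      using chain_snoc[OF mid[symmetric], of 2 n] by (simp add: norm_mult mult_ac R_def p)
  qed (use \<delta> in auto)
qed

subsection \<open>Head and tail sums\<close>

text \<open>The summand of \<open>Z\<close> with natural exponents; products of such factors add
  their exponent triples.\<close>

definition F :: "nat \<Rightarrow> nat \<Rightarrow> nat \<Rightarrow> nat \<Rightarrow> complex" where
  "F a b c n = 1 / ((of_nat n + \<alpha>) ^ a * (of_nat n + \<beta>) ^ b * (of_nat n + \<gamma>) ^ c)"

lemma F_mult: "F a b c n * F a' b' c' n = F (a + a') (b + b') (c + c') n"
  by (simp add: F_def power_add)

lemma P_eq_F: "k \<ge> 2 \<Longrightarrow> P k n = F 1 1 (k - 2) n"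
  by (simp add: F_def P_eq x_def power_one_over)

lemma x_power_eq_F: "x n ^ i = F 0 0 i n"
  by (simp add: F_def x_def power_one_over)

lemma F_summable:
  assumes "a + b + c \<ge> 2"
  shows "F a b c summable_on UNIV"
proof (rule abs_summable_summable)
  obtain C1 where C1: "C1 > 0" "\<And>n::nat. norm ((1 / (of_nat n + \<alpha>)) ^ a) \<le> C1 * (real n + 1) powr (- real a)"
    using inverse_power_bound[OF \<alpha>] by blast
  obtain C2 where C2: "C2 > 0" "\<And>n::nat. norm ((1 / (of_nat n + \<beta>)) ^ b) \<le> C2 * (real n + 1) powr (- real b)"
    using inverse_power_bound[OF \<beta>] by blast
  obtain C3 where C3: "C3 > 0" "\<And>n::nat. norm ((1 / (of_nat n + \<gamma>)) ^ c) \<le> C3 * (real n + 1) powr (- real c)"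
    using inverse_power_bound[OF \<gamma>] by blast
  have "(\<lambda>n. C1 * C2 * C3 * (real n + 1) powr (- real (a + b + c))) summable_on UNIV"
    by (intro summable_on_cmult_right summable_on_powr) (use assms in linarith)
  then show "(\<lambda>n. norm (F a b c n)) summable_on UNIV"
  proof (rule Infinite_Sum.abs_summable_on_comparison_test')
    fix n
    have "norm (F a b c n) = norm ((1 / (of_nat n + \<alpha>)) ^ a) * norm ((1 / (of_nat n + \<beta>)) ^ b)
        * norm ((1 / (of_nat n + \<gamma>)) ^ c)"
      by (simp add: F_def norm_mult norm_divide norm_power power_one_over)
    also have "\<dots> \<le> (C1 * (real n + 1) powr (- real a)) * (C2 * (real n + 1) powr (- real b))
        * (C3 * (real n + 1) powr (- real c))"
      by (intro mult_mono C1 C2 C3) (use C1 C2 C3 in auto)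
    also have "\<dots> = C1 * C2 * C3 * ((real n + 1) powr (- real a) * (real n + 1) powr (- real b)
        * (real n + 1) powr (- real c))"
      by (simp only: mult_ac)
    also have "(real n + 1) powr (- real a) * (real n + 1) powr (- real b) * (real n + 1) powr (- real c)
        = (real n + 1) powr (- real (a + b + c))"
      unfolding powr_add[symmetric] by simp
    finally show "norm (F a b c n) \<le> C1 * C2 * C3 * (real n + 1) powr (- real (a + b + c))" .
  qed
qed

lemma Z_eq_infsum:
  assumes "a + b + c \<ge> 2"
  shows "Z (int a) (int b) (int c) \<alpha> \<beta> \<gamma> = (\<Sum>\<^sub>\<infinity>n. F a b c n)"
proof -
  have "(F a b c has_sum (\<Sum>\<^sub>\<infinity>n. F a b c n)) UNIV"
    using F_summable[OF assms] by simp
  then have "(\<Sum>n. F a b c n) = (\<Sum>\<^sub>\<infinity>n. F a b c n)"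
    using has_sum_imp_sums sums_unique by metis
  then show ?thesis
    by (simp add: Z_def F_def power_int_of_nat)
qed

lemma chain_replicate:
  "\<forall>k\<in>set ks. k \<ge> 2 \<Longrightarrow>
    chain ks (replicate (length ks) n) = F (length ks) (length ks) (sum_list ks - 2 * length ks) n"
proof (induction ks)
  case Nil
  then show ?case by (simp add: F_def)
next
  case (Cons k ks)
  \<comment> \<open>The truncated subtractions are exact because every entry is at least 2.\<close>
  moreover have "k - 2 + (sum_list ks - 2 * length ks) = sum_list (k # ks) - 2 * length (k # ks)"
    using Cons.prems sum_list_ge[of ks] by simp
  ultimately show ?case
    by (simp add: P_eq_F F_mult)
qed

definition head_sum :: "nat list \<Rightarrow> complex" where
  "head_sum ks = infsum (head_term ks) (sorted_lists (Suc (length ks)))"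

definition tail_sum :: "nat list \<Rightarrow> complex" where
  "tail_sum ks = infsum (tail_term ks) (sorted_lists (Suc (length ks)))"

text \<open>At the last variable each \<open>P (k - j)\<close> is a power of \<open>x\<close> times
  \<open>P 2\<close>, so the sum over j is a geometric sum in the two outer values of
  \<open>x\<close>.\<close>

lemma sum_Z_I_term:
  assumes l: "l \<in> sorted_lists (Suc (Suc (length ks)))" and k: "k \<ge> 2"
  shows "(\<Sum>j<k - 2. w (hd l) * v (last l) * x (hd l) ^ (j + 1) * chain (ks @ [k - j]) (tl l))
    = head_term (k # ks) l - tail_term (ks @ [k]) l
      + (if hd l = last l then of_nat (k - 2) * x (hd l) ^ (k - 1) * chain (ks @ [2]) (tl l) else 0)"
proof -
  obtain m mid n where mid: "length mid = length ks" and l_eq: "l = m # mid @ [n]"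
    using l by (rule sorted_lists_framedE) auto
  define c where "c = w m * v n * P 2 n * chain ks mid"
  have P: "P i n = x n ^ (i - 2) * P 2 n" if "i \<ge> 2" for i
    using that by (simp add: P_eq)
  have "(\<Sum>j<k - 2. w m * v n * x m ^ (j + 1) * chain (ks @ [k - j]) (mid @ [n]))
      = (\<Sum>j<k - 2. c * (x m ^ (j + 1) * x n ^ (k - 2 - j)))"
  proof (rule sum.cong)
    fix j assume "j \<in> {..<k - 2}"
    then have "k - j - 2 = k - 2 - j" "k - j \<ge> 2" by auto
    then show "w m * v n * x m ^ (j + 1) * chain (ks @ [k - j]) (mid @ [n])
        = c * (x m ^ (j + 1) * x n ^ (k - 2 - j))"
      using mid P[of "k - j"] by (simp add: c_def mult_ac)
  qed simp
  also have "\<dots> = c * (x m ^ (k - 2) / (of_nat n - of_nat m) - x n ^ (k - 2) / (of_nat n - of_nat m)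
      + (if m = n then of_nat (k - 2) * x m ^ (k - 2 + 1) else 0))"
    unfolding sum_distrib_left[symmetric] x_def by (subst geometric_difference) simp_all
  also have "\<dots> = c * x m ^ (k - 2) / (of_nat n - of_nat m) - c * x n ^ (k - 2) / (of_nat n - of_nat m)
      + (if m = n then of_nat (k - 2) * x m ^ (k - 2 + 1) * c else 0)"
    by (simp add: algebra_simps)
  also have "c * x m ^ (k - 2) / (of_nat n - of_nat m) = head_term (k # ks) l"
  proof -
    have "head_term (k # ks) l = (s m * P k m) * (v n * P 2 n) / (of_nat n - of_nat m) * chain ks mid"
      by (simp add: l_eq head_term_def butlast_append u_eq mult_ac)
    then show ?thesis
      unfolding s_P[OF k] by (simp add: c_def mult_ac)
  qed
  also have "c * x n ^ (k - 2) / (of_nat n - of_nat m) = tail_term (ks @ [k]) l"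
    using mid P[OF k] by (simp add: l_eq tail_term_def c_def mult_ac)
  also have "(if m = n then of_nat (k - 2) * x m ^ (k - 2 + 1) * c else 0)
      = (if m = n then of_nat (k - 2) * x m ^ (k - 1) * chain (ks @ [2]) (mid @ [n]) else 0)"
    using k mid by (simp add: c_def Suc_diff_le[symmetric] numeral_2_eq_2)
  finally show ?thesis by (simp add: l_eq)
qed

text \<open>The termwise identity summed over all lists. The lists \<open>k # ks\<close> and
  \<open>ks @ [k]\<close> are consecutive rotations, so the tail sum belongs to the next step of the
  cycle.\<close>

lemma sum_Z_I_star:
  assumes "\<forall>i\<in>set (k # ks). i \<ge> 2"
  defines "d \<equiv> length (k # ks)" and "r \<equiv> sum_list (k # ks)"
  shows "(\<Sum>j<k - 2. Z_I_star ((j + 1) # ks @ [k - j]) \<alpha> \<beta> \<gamma>)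
    = head_sum (k # ks) - tail_sum (ks @ [k]) + of_nat (k - 2) * Z (int d) (int d) (int (r - 2 * d + 1)) \<alpha> \<beta> \<gamma>"
proof -
  define S where "S = sorted_lists (Suc (Suc (length ks)))"
  define f where "f j l = w (hd l) * v (last l) * x (hd l) ^ (j + 1) * chain (ks @ [k - j]) (tl l)" for j l
  define g where "g l = of_nat (k - 2) * x (hd l) ^ (k - 1) * chain (ks @ [2]) (tl l)" for l
  have k: "k \<ge> 2" using assms by simp
  have f: "f j summable_on S" if "j \<in> {..<k - 2}" for j
    unfolding f_def S_def by (rule Z_I_star_summable) (use assms that in auto)
  have head: "head_term (k # ks) summable_on S" and tail: "tail_term (ks @ [k]) summable_on S"
    using assms head_term_summable tail_term_summable unfolding S_def by auto
  \<comment> \<open>Solved for the diagonal term, whose sum then follows from the summability of the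
    other three.\<close>
  have term_eq: "(if hd l = last l then g l else 0)
      = (\<Sum>j<k - 2. f j l) - head_term (k # ks) l + tail_term (ks @ [k]) l" if "l \<in> S" for l
    using sum_Z_I_term[of l ks k] that k by (simp add: S_def f_def g_def)
  have "(\<Sum>\<^sub>\<infinity>n. g (replicate (Suc (Suc (length ks))) n)) = (\<Sum>\<^sub>\<infinity>l\<in>S. if hd l = last l then g l else 0)"
    unfolding S_def by (rule infsum_diagonal[symmetric])
  also have "\<dots> = (\<Sum>\<^sub>\<infinity>l\<in>S. (\<Sum>j<k - 2. f j l) + - head_term (k # ks) l + tail_term (ks @ [k]) l)"
    by (rule infsum_cong) (use term_eq in simp)
  also have "\<dots> = (\<Sum>j<k - 2. infsum (f j) S) - head_sum (k # ks) + tail_sum (ks @ [k])"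
  proof (rule infsumI)
    have "((\<lambda>l. (\<Sum>j<k - 2. f j l) + - head_term (k # ks) l + tail_term (ks @ [k]) l) has_sum
        (\<Sum>j<k - 2. infsum (f j) S) + - head_sum (k # ks) + tail_sum (ks @ [k])) S"
    proof (intro has_sum_add)
      show "((\<lambda>l. \<Sum>j<k - 2. f j l) has_sum (\<Sum>j<k - 2. infsum (f j) S)) S"
        using infsum_sum_finite[of "{..<k - 2}" f S, OF f] has_sum_infsum by metis
    qed (use head tail in \<open>simp_all add: has_sum_uminus head_sum_def tail_sum_def S_def\<close>)
    then show "((\<lambda>l. (\<Sum>j<k - 2. f j l) + - head_term (k # ks) l + tail_term (ks @ [k]) l) has_sum
        (\<Sum>j<k - 2. infsum (f j) S) - head_sum (k # ks) + tail_sum (ks @ [k])) S"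
      by simp
  qed
  finally have "(\<Sum>j<k - 2. infsum (f j) S) = head_sum (k # ks) - tail_sum (ks @ [k])
      + (\<Sum>\<^sub>\<infinity>n. g (replicate (Suc (Suc (length ks))) n))"
    by simp
  moreover have "infsum (f j) S = Z_I_star ((j + 1) # ks @ [k - j]) \<alpha> \<beta> \<gamma>" for j
    by (simp add: Z_I_star_eq f_def[abs_def] S_def)
  moreover have "g (replicate (Suc (Suc (length ks))) n) = of_nat (k - 2) * F d d (r - 2 * d + 1) n" for n
  proof -
    have "2 * length ks \<le> sum_list ks"
      using assms by (intro sum_list_ge) auto
    \<comment> \<open>The diagonal product has third exponent r - k - 2 (d - 1), and the power of
      \<open>x\<close> adds k - 1.\<close>
    then have "sum_list (ks @ [2]) - 2 * length (ks @ [2]) + (k - 1) = r - 2 * d + 1"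
      using k by (simp add: r_def d_def)
    moreover have "chain (ks @ [2]) (replicate (Suc (length ks)) n)
        = F d d (sum_list (ks @ [2]) - 2 * length (ks @ [2])) n"
      using chain_replicate[of "ks @ [2]" n] assms by (simp add: d_def)
    ultimately show ?thesis
      by (simp add: g_def x_power_eq_F F_mult add.commute)
  qed
  moreover have "(\<Sum>\<^sub>\<infinity>n. of_nat (k - 2) * F d d (r - 2 * d + 1) n)
      = of_nat (k - 2) * Z (int d) (int d) (int (r - 2 * d + 1)) \<alpha> \<beta> \<gamma>"
    by (subst Z_eq_infsum) (simp_all add: infsum_cmult_right' d_def)
  ultimately show ?thesis by simp
qed

section \<open>Summation of the telescoping identity\<close>

text \<open>Dividing \<open>v n\<close> by n - m gains one power of n, leaving decay of order Re t,
  which is positive.\<close>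

lemma H_tendsto_0: "H p \<longlonglongrightarrow> 0"
proof -
  obtain C where C: "C > 0" "\<And>n. norm (v n) \<le> C * (real n + 1) powr (1 - Re t)"
    using weight_bounds by metis
  have "(\<lambda>n. v n / of_nat (Suc n)) \<longlonglongrightarrow> 0"
  proof (rule Lim_null_comparison)
    show "\<forall>\<^sub>F n in sequentially. norm (v n / of_nat (Suc n)) \<le> C * real (Suc n) powr (- Re t)"
    proof (intro always_eventually allI)
      fix n
      have "norm (v n / of_nat (Suc n)) \<le> C * (real n + 1) powr (1 - Re t) / (real n + 1)"
        using C(2)[of n] by (simp add: norm_divide divide_right_mono add.commute flip: of_nat_Suc)
      also have "\<dots> = C * ((real n + 1) powr (1 - Re t) / (real n + 1) powr 1)"
        by simp
      also have "(real n + 1) powr (1 - Re t) / (real n + 1) powr 1 = (real n + 1) powr (- Re t)"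
        unfolding powr_diff[symmetric] by simp
      finally show "norm (v n / of_nat (Suc n)) \<le> C * real (Suc n) powr (- Re t)"
        by (simp add: add.commute)
    qed
    have "(\<lambda>n. real (Suc n) powr (- Re t)) \<longlonglongrightarrow> 0"
      using Re_t_pos by (intro tendsto_neg_powr filterlim_compose[OF filterlim_real_sequentially] filterlim_Suc) auto
    then show "(\<lambda>n. C * real (Suc n) powr (- Re t)) \<longlonglongrightarrow> 0"
      using tendsto_mult_right_zero by blast
  qed
  \<comment> \<open>For n > m this is (n + 1) / (n - m), which replaces the denominator n + 1 by n -
    m.\<close>
  moreover have "(\<lambda>n. 1 + (1 + of_nat m) * (1 / (of_nat n + (- of_nat m)))) \<longlonglongrightarrow> 1 + (1 + of_nat m) * (0 :: complex)" for m :: nat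
    by (intro tendsto_intros tendsto_divide_0[OF tendsto_const] tendsto_add_filterlim_at_infinity'
        [OF tendsto_of_nat tendsto_const])
  ultimately have "(\<lambda>n. v n / of_nat (Suc n) * (1 + (1 + of_nat m) * (1 / (of_nat n + (- of_nat m)))))
      \<longlonglongrightarrow> 0 * (1 + (1 + of_nat m) * 0)" for m :: nat
    by (intro tendsto_mult)
  then have lim: "(\<lambda>n. v n / of_nat (Suc n) * (1 + (1 + of_nat m) * (1 / (of_nat n + (- of_nat m)))))
      \<longlonglongrightarrow> 0" for m :: nat
    by simp
  have "(\<lambda>n. v n / (of_nat n - of_nat m)) \<longlonglongrightarrow> 0" for m :: nat
  proof (rule Lim_transform_eventually[OF lim[of m]])
    show "\<forall>\<^sub>F n in sequentially. v n / of_nat (Suc n) * (1 + (1 + of_nat m) * (1 / (of_nat n + (- of_nat m))))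
        = v n / (of_nat n - of_nat m)"
      using eventually_gt_at_top[of m]
    proof eventually_elim
      case (elim n)
      then have nz: "of_nat n - of_nat m \<noteq> (0 :: complex)"
        by simp
      have "1 + (1 + of_nat m) * (1 / (of_nat n + (- of_nat m))) = of_nat (Suc n) / (of_nat n - of_nat m :: complex)"
        using nz by (simp add: field_simps)
      then show ?case
        using of_nat_neq_0[of n, where 'a = complex] by (simp del: of_nat_Suc)
    qed
  qed
  then have "(\<lambda>n. \<Sum>m\<le>p. w m * (v n / (of_nat n - of_nat m))) \<longlonglongrightarrow> (\<Sum>m\<le>p. w m * 0)"
    by (intro tendsto_intros)
  then show ?thesis
    by (simp add: H_def[abs_def])
qed

text \<open>The factor \<open>c\<close> will be \<open>chain ks p\<close>; it is carried along
  because summability is inherited from the multiple series, which contains it.\<close>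

lemma infsum_G:
  assumes "p \<le> q" and sum: "(\<lambda>n. c * G p n) summable_on {q..}"
  shows "(\<Sum>\<^sub>\<infinity>n\<in>{q..}. c * G p n)
    = c * H p q + (if p = q then c * (1 / (of_nat p + \<alpha>) + 1 / (of_nat p + \<beta>)) else 0)"
proof -
  define e where "e = (if p = q then c * (1 / (of_nat p + \<alpha>) + 1 / (of_nat p + \<beta>)) else 0)"
  have bij: "bij_betw (\<lambda>i. q + i) UNIV {q..}"
    by (rule bij_betwI[where g = "\<lambda>n. n - q"]) auto
  have "((\<lambda>n. c * G p n) has_sum (\<Sum>\<^sub>\<infinity>n\<in>{q..}. c * G p n)) {q..}"
    using sum by simp
  then have "((\<lambda>i. c * G p (q + i)) has_sum (\<Sum>\<^sub>\<infinity>n\<in>{q..}. c * G p n)) UNIV"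
    by (subst has_sum_reindex_bij_betw[OF bij])
  then have sums: "(\<lambda>i. c * G p (q + i)) sums (\<Sum>\<^sub>\<infinity>n\<in>{q..}. c * G p n)"
    by (rule has_sum_imp_sums)
  \<comment> \<open>At least one term is summed, so the only possible diagonal term, n = p when p =
    q, falls in the base case.\<close>
  have "(\<Sum>i<Suc M. c * G p (q + i)) = c * H p q + e - c * H p (q + Suc M)" for M
  proof (induction M)
    case 0
    then show ?case
      by (simp add: G_telescope[OF assms(1)] e_def right_diff_distrib distrib_left)
  next
    case (Suc M)
    have "G p (q + Suc M) = H p (q + Suc M) - H p (q + Suc (Suc M))"
      using G_telescope_off_diagonal[of p "q + Suc M"] assms(1) by simp
    then show ?case
      by (subst sum.lessThan_Suc) (simp only: Suc.IH right_diff_distrib, simp)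
  qed
  moreover have lim: "(\<lambda>M. c * H p q + e - c * H p (q + Suc M)) \<longlonglongrightarrow> c * H p q + e - c * 0"
    using LIMSEQ_ignore_initial_segment[OF H_tendsto_0[of p], of "q + 1"]
    by (intro tendsto_intros) (simp add: add_ac)
  moreover have "(\<lambda>M. \<Sum>i<Suc M. c * G p (q + i)) \<longlonglongrightarrow> (\<Sum>\<^sub>\<infinity>n\<in>{q..}. c * G p n)"
    using sums unfolding sums_def by (rule LIMSEQ_Suc)
  ultimately have "(\<lambda>M. c * H p q + e - c * H p (q + Suc M)) \<longlonglongrightarrow> (\<Sum>\<^sub>\<infinity>n\<in>{q..}. c * G p n)"
    by simp
  from LIMSEQ_unique[OF this lim] show ?thesis
    by (simp add: e_def)
qed

text \<open>With the list \<open>p\<close> carrying \<open>chain ks p\<close> fixed, the left side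
  sums \<open>G\<close> over a larger last variable and the right side sums \<open>H\<close> over a
  smaller first one, so \<open>infsum_G\<close> applies for each \<open>p\<close>.\<close>

lemma head_sum_add_Z_II_star:
  assumes ks: "\<forall>i\<in>set ks. i \<ge> 2" and "ks \<noteq> []"
  defines "d \<equiv> length ks" and "r \<equiv> sum_list ks"
  shows "head_sum ks + t * Z_II_star (ks @ [2]) \<alpha> \<beta> \<gamma>
    = tail_sum ks + Z (int d) (int (d + 1)) (int (r - 2 * d)) \<alpha> \<beta> \<gamma>
      + Z (int (d + 1)) (int d) (int (r - 2 * d)) \<alpha> \<beta> \<gamma>"
proof -
  obtain N where N: "length ks = Suc N"
    using \<open>ks \<noteq> []\<close> by (cases ks) auto
  obtain k ks' where Cons: "ks = k # ks'"
    using \<open>ks \<noteq> []\<close> by (cases ks) auto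
  obtain k2 ks2 where snoc: "ks = ks2 @ [k2]"
    using \<open>ks \<noteq> []\<close> by (cases ks rule: rev_cases) auto
  have head: "head_term ks summable_on sorted_lists (Suc (Suc N))"
    using head_term_summable[of k ks'] ks N unfolding Cons by simp
  have tail: "tail_term ks summable_on sorted_lists (Suc (Suc N))"
    using tail_term_summable[of k2 ks2] ks N unfolding snoc by simp
  define f where "f l = w (hd l) * v (last l) * chain (ks @ [2]) (tl l)" for l
  have f: "f summable_on sorted_lists (Suc (Suc (Suc N)))"
    using Z_II_star_summable[OF ks \<open>ks \<noteq> []\<close>] unfolding f_def N .
  \<comment> \<open>Summing out the smallest variable of \<open>Z_II_star\<close> leaves the same
    variables as in \<open>head_term\<close>.\<close>
  define E where "E l = head_term ks l + t * (\<Sum>m\<le>hd l. f (m # l))" for l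
  have E: "E summable_on sorted_lists (Suc (Suc N))"
    unfolding E_def by (intro summable_on_add head summable_on_cmult_right sum_sorted_lists_Cons(1) f)
  have "infsum E (sorted_lists (Suc (Suc N))) = head_sum ks + t * Z_II_star (ks @ [2]) \<alpha> \<beta> \<gamma>"
    unfolding E_def using head sum_sorted_lists_Cons[OF f]
    by (simp add: infsum_add summable_on_cmult_right infsum_cmult_right' head_sum_def Z_II_star_eq N f_def[abs_def])
  then have 1: "head_sum ks + t * Z_II_star (ks @ [2]) \<alpha> \<beta> \<gamma>
      = (\<Sum>\<^sub>\<infinity>p\<in>sorted_lists (Suc N). \<Sum>\<^sub>\<infinity>n\<in>{last p..}. E (p @ [n]))"
    using sum_sorted_lists_snoc(3)[OF E] by simp
  have E_eq: "E (p @ [n]) = chain ks p * G (hd p) n" if p: "p \<in> sorted_lists (Suc N)" for p n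
  proof -
    have p': "length p = length ks" "p \<noteq> []"
      using p N by (auto simp: sorted_lists_def)
    then have "chain (ks @ [2]) (p @ [n]) = chain ks p * P 2 n"
      by simp
    then show ?thesis
      using p' by (simp add: E_def head_term_def f_def G_def u_eq sum_distrib_left algebra_simps)
  qed
  define D where "D p = chain ks p * (1 / (of_nat (hd p) + \<alpha>) + 1 / (of_nat (hd p) + \<beta>))" for p
  have E_sum: "(\<Sum>\<^sub>\<infinity>n\<in>{last p..}. E (p @ [n]))
      = (\<Sum>m\<le>hd p. tail_term ks (m # p)) + (if hd p = last p then D p else 0)"
    if p: "p \<in> sorted_lists (Suc N)" for p
  proof -
    have p': "p \<noteq> []" "hd p \<le> last p"
      using p by (cases p; auto simp: sorted_lists_def)+
    have "(\<lambda>n. chain ks p * G (hd p) n) summable_on {last p..}"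
      using sum_sorted_lists_snoc(1)[OF E p] by (simp add: E_eq[OF p])
    then have "(\<Sum>\<^sub>\<infinity>n\<in>{last p..}. E (p @ [n])) = chain ks p * H (hd p) (last p) + (if hd p = last p then D p else 0)"
      unfolding E_eq[OF p] D_def by (rule infsum_G[OF p'(2)])
    also have "chain ks p * H (hd p) (last p) = (\<Sum>m\<le>hd p. tail_term ks (m # p))"
      using p' by (simp add: H_def tail_term_def sum_distrib_left mult_ac)
    finally show ?thesis .
  qed
  \<comment> \<open>The diagonal part is a difference of two summable functions.\<close>
  have D_summable: "(\<lambda>p. if hd p = last p then D p else 0) summable_on sorted_lists (Suc N)"
  proof -
    have "(\<lambda>p. - (\<Sum>m\<le>hd p. tail_term ks (m # p))) summable_on sorted_lists (Suc N)"
      unfolding summable_on_uminus by (rule sum_sorted_lists_Cons(1)[OF tail])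
    from summable_on_add[OF sum_sorted_lists_snoc(2)[OF E] this]
    have "(\<lambda>p. (\<Sum>\<^sub>\<infinity>n\<in>{last p..}. E (p @ [n])) + - (\<Sum>m\<le>hd p. tail_term ks (m # p)))
        summable_on sorted_lists (Suc N)" .
    also have "?this \<longleftrightarrow> (\<lambda>p. if hd p = last p then D p else 0) summable_on sorted_lists (Suc N)"
      by (rule summable_on_cong) (simp add: E_sum)
    finally show ?thesis .
  qed
  have "(\<Sum>\<^sub>\<infinity>p\<in>sorted_lists (Suc N). \<Sum>\<^sub>\<infinity>n\<in>{last p..}. E (p @ [n]))
      = (\<Sum>\<^sub>\<infinity>p\<in>sorted_lists (Suc N). (\<Sum>m\<le>hd p. tail_term ks (m # p)) + (if hd p = last p then D p else 0))"
    by (rule infsum_cong) (rule E_sum)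
  also have "\<dots> = tail_sum ks + (\<Sum>\<^sub>\<infinity>n. D (replicate (Suc N) n))"
    using sum_sorted_lists_Cons[OF tail] D_summable
    by (simp add: infsum_add infsum_diagonal tail_sum_def N del: replicate_Suc)
  also have "(\<Sum>\<^sub>\<infinity>n. D (replicate (Suc N) n))
      = (\<Sum>\<^sub>\<infinity>n. F d (d + 1) (r - 2 * d) n + F (d + 1) d (r - 2 * d) n)"
  proof (rule infsum_cong)
    fix n
    have "chain ks (replicate (Suc N) n) = F d d (r - 2 * d) n"
      using chain_replicate[OF ks, of n] by (simp add: N d_def r_def)
    moreover have "1 / (of_nat n + \<alpha>) = F 1 0 0 n" "1 / (of_nat n + \<beta>) = F 0 1 0 n"
      by (simp_all add: F_def)
    ultimately show "D (replicate (Suc N) n) = F d (d + 1) (r - 2 * d) n + F (d + 1) d (r - 2 * d) n"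
      by (simp add: D_def F_mult distrib_left add.commute del: replicate_Suc)
  qed
  also have "(\<Sum>\<^sub>\<infinity>n. F d (d + 1) (r - 2 * d) n + F (d + 1) d (r - 2 * d) n)
      = (\<Sum>\<^sub>\<infinity>n. F d (d + 1) (r - 2 * d) n) + (\<Sum>\<^sub>\<infinity>n. F (d + 1) d (r - 2 * d) n)"
    by (intro infsum_add F_summable) (simp_all add: d_def N)
  also have "\<dots> = Z (int d) (int (d + 1)) (int (r - 2 * d)) \<alpha> \<beta> \<gamma> + Z (int (d + 1)) (int d) (int (r - 2 * d)) \<alpha> \<beta> \<gamma>"
    by (subst (1 2) Z_eq_infsum) (simp_all add: d_def N)
  finally show ?thesis
    unfolding 1 by (simp add: add.assoc)
qed

end

subsection \<open>The cyclic sum formula\<close>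

text \<open>The range \<open>j < ks ! i - 2\<close> is that of j from 0 to k_i - 3, empty for k_i =
  2. Positions count from 0, so \<open>drop i ks @ take i ks\<close> begins with the entry called
  k_(i+1) in one-based numbering.\<close>

theorem theorem2p11:
  fixes \<alpha> \<beta> \<gamma> t :: complex and ks :: "nat list" and d k :: nat
  assumes "Re (\<alpha> + \<beta> - \<gamma>) > 0"
    and "\<alpha> \<notin> \<int>\<^sub>\<le>\<^sub>0" and "\<beta> \<notin> \<int>\<^sub>\<le>\<^sub>0" and "\<gamma> \<notin> \<int>\<^sub>\<le>\<^sub>0"
    and "t = \<alpha> + \<beta> - \<gamma>"
    and "d = length ks" and "d \<ge> 1"
    and "\<forall>i<d. ks ! i \<ge> 2"
    and "k = sum_list ks"
  shows "(\<Sum>i<d. \<Sum>j<ks ! i - 2.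
            Z_I_star ([j + 1] @ drop (i + 1) ks @ take i ks @ [ks ! i - j]) \<alpha> \<beta> \<gamma>)
         + t * (\<Sum>i<d. Z_II_star (drop i ks @ take i ks @ [2]) \<alpha> \<beta> \<gamma>)
       = of_nat d * Z (int d) (int d + 1) (int k - 2 * int d) \<alpha> \<beta> \<gamma>
         + of_nat d * Z (int d + 1) (int d) (int k - 2 * int d) \<alpha> \<beta> \<gamma>
         + of_int (int k - 2 * int d) * Z (int d) (int d) (int k - 2 * int d + 1) \<alpha> \<beta> \<gamma>"
proof -
  interpret hyp_params \<alpha> \<beta> \<gamma> t
    by unfold_locales (use assms in auto)
  have ge: "\<forall>i\<in>set ks. i \<ge> 2"
    using assms by (auto simp: in_set_conv_nth)
  have kd: "2 * d \<le> k"
    using sum_list_ge[OF ge] assms by simp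
  define \<kappa> where "\<kappa> i = rotate i ks" for i
  define Z1 where "Z1 = Z (int d) (int d) (int (k - 2 * d + 1)) \<alpha> \<beta> \<gamma>"
  define Z2 where "Z2 = Z (int d) (int (d + 1)) (int (k - 2 * d)) \<alpha> \<beta> \<gamma>
    + Z (int (d + 1)) (int d) (int (k - 2 * d)) \<alpha> \<beta> \<gamma>"
  have \<kappa>: "set (\<kappa> i) = set ks" "length (\<kappa> i) = d" "sum_list (\<kappa> i) = k" for i
    using assms by (simp_all add: \<kappa>_def sum_list_rotate)
  have split: "\<kappa> i = drop i ks @ take i ks" "\<kappa> i = ks ! i # drop (i + 1) ks @ take i ks" if "i < d" for i
    using that assms by (auto simp: \<kappa>_def rotate_drop_take Cons_nth_drop_Suc)
  have I: "(\<Sum>j<ks ! i - 2. Z_I_star ([j + 1] @ drop (i + 1) ks @ take i ks @ [ks ! i - j]) \<alpha> \<beta> \<gamma>)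
      = head_sum (\<kappa> i) - tail_sum (\<kappa> (Suc i)) + of_nat (ks ! i - 2) * Z1" if i: "i < d" for i
  proof -
    define rest where "rest = drop (i + 1) ks @ take i ks"
    have 1: "\<kappa> i = ks ! i # rest"
      using split(2)[OF i] by (simp only: rest_def)
    \<comment> \<open>One further rotation moves the first entry to the end.\<close>
    have 2: "\<kappa> (Suc i) = rest @ [ks ! i]"
      using 1 by (simp add: \<kappa>_def)
    have "(\<Sum>j<ks ! i - 2. Z_I_star ((j + 1) # rest @ [ks ! i - j]) \<alpha> \<beta> \<gamma>)
      = head_sum (\<kappa> i) - tail_sum (\<kappa> (Suc i)) + of_nat (ks ! i - 2) * Z1"
      using sum_Z_I_star[of "ks ! i" rest] ge unfolding 1[symmetric] 2[symmetric] \<kappa> Z1_def by blast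
    then show ?thesis
      by (simp only: rest_def append_Cons append_Nil append_assoc)
  qed
  have II: "t * Z_II_star (drop i ks @ take i ks @ [2]) \<alpha> \<beta> \<gamma> = tail_sum (\<kappa> i) - head_sum (\<kappa> i) + Z2"
    if i: "i < d" for i
  proof -
    have "\<kappa> i \<noteq> []"
      using \<kappa>(2)[of i] assms by auto
    moreover have "\<forall>j\<in>set (\<kappa> i). j \<ge> 2"
      unfolding \<kappa> by (rule ge)
    ultimately have "head_sum (\<kappa> i) + t * Z_II_star (\<kappa> i @ [2]) \<alpha> \<beta> \<gamma> = tail_sum (\<kappa> i) + Z2"
      using head_sum_add_Z_II_star[of "\<kappa> i"] unfolding \<kappa> Z2_def add.assoc by blast
    then have "t * Z_II_star (\<kappa> i @ [2]) \<alpha> \<beta> \<gamma> = tail_sum (\<kappa> i) + Z2 - head_sum (\<kappa> i)"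
      by (simp only: eq_diff_eq add.commute)
    moreover have "\<kappa> i @ [2] = drop i ks @ take i ks @ [2]"
      unfolding split(1)[OF i] by simp
    ultimately show ?thesis
      by (simp only: diff_add_eq)
  qed
  \<comment> \<open>The cycle closes, so shifting the index of the tail sums leaves no boundary
    term.\<close>
  have "\<kappa> d = \<kappa> 0"
    using assms by (simp add: \<kappa>_def)
  then have shift: "(\<Sum>i<d. tail_sum (\<kappa> (Suc i))) = (\<Sum>i<d. tail_sum (\<kappa> i))"
    using sum.lessThan_Suc_shift[of "\<lambda>i. tail_sum (\<kappa> i)" d] by simp
  have "(\<Sum>i<d. ks ! i - 2) = k - 2 * d"
    using assms by (subst sum_subtractf_nat) (auto simp: sum_list_sum_nth atLeast0LessThan)
  then have "(\<Sum>i<d. of_nat (ks ! i - 2)) = (of_nat (k - 2 * d) :: complex)"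
    by (simp flip: of_nat_sum)
  then have "(\<Sum>i<d. of_nat (ks ! i - 2) * Z1) = of_nat (k - 2 * d) * Z1"
    by (simp flip: sum_distrib_right)
  moreover have "(\<Sum>i<d. \<Sum>j<ks ! i - 2.
            Z_I_star ([j + 1] @ drop (i + 1) ks @ take i ks @ [ks ! i - j]) \<alpha> \<beta> \<gamma>)
      = (\<Sum>i<d. head_sum (\<kappa> i) - tail_sum (\<kappa> (Suc i)) + of_nat (ks ! i - 2) * Z1)"
    by (intro sum.cong refl I) simp
  moreover have "t * (\<Sum>i<d. Z_II_star (drop i ks @ take i ks @ [2]) \<alpha> \<beta> \<gamma>)
      = (\<Sum>i<d. tail_sum (\<kappa> i) - head_sum (\<kappa> i) + Z2)"
    unfolding sum_distrib_left by (intro sum.cong refl II) simp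
  ultimately have "(\<Sum>i<d. \<Sum>j<ks ! i - 2.
            Z_I_star ([j + 1] @ drop (i + 1) ks @ take i ks @ [ks ! i - j]) \<alpha> \<beta> \<gamma>)
         + t * (\<Sum>i<d. Z_II_star (drop i ks @ take i ks @ [2]) \<alpha> \<beta> \<gamma>)
       = of_nat d * Z2 + of_nat (k - 2 * d) * Z1"
    by (simp only: sum.distrib sum_subtractf shift) simp
  moreover have "int (k - 2 * d) = int k - 2 * int d" "of_nat (k - 2 * d) = (of_int (int k - 2 * int d) :: complex)"
    using kd by (simp_all add: of_nat_diff)
  ultimately show ?thesis
    by (simp only: Z1_def Z2_def distrib_left of_nat_add of_nat_1)
qed

end
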